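(* Let $(\mathcal C,\otimes,\mathbf I)$ be a strict monoidal category. Let $(V_k,\mu_k,\nu_k)_{1\le k\le r}$ be unital associative algebras in $\mathcal C$, each $\nu_k$ being part of a normalized pair $(\nu_k,\epsilon_k)$, and let $\xi_{k,l}\colon V_k\otimes V_l\to V_l\otimes V_k$ ($1\le k<l\le r$) be morphisms natural with respect to $\nu_k$ and $\nu_l$ and making $(V_1,\dots,V_r)$ a braided system of unital associative algebras. Suppose that $\xi_{i,i+1}$ is invertible for some $i$. Then: 1. The algebras $V_1,\dots,V_{i-1},V_{i+1},V_i,V_{i+2},\dots,V_r$ (in this order), endowed with the $\xi$'s of the original system, completed with $\xi_{i,i+1}^{-1}$ on $V_{i+1}\otimes V_i$, still form a braided system of unital associative algebras. 2. Let $\overleftarrow V$ be the braided tensor product algebra of the original system and let $s_i\cdot\overleftarrow V$, with underlying object $V_r\otimes\cdots\otimes V_{i+2}\otimes V_i\otimes V_{i+1}\otimes V_{i-1}\otimes\cdots\otimes V_1$, be that of the system from part 1. Then $$s_i:=\mathrm{Id}_{r}\otimes\cdots\otimes\mathrm{Id}_{i+2}\otimes\xi_{i,i+1}^{-1}\otimes\mathrm{Id}_{i-1}\otimes\cdots\otimes\mathrm{Id}_1\colon\ \overleftarrow V\longrightarrow s_i\cdot\overleftarrow V$$ is an algebra isomorphism. 3. This algebra isomorphism induces an equivalence of right module categories $$\mathbf{Mod}_{\overleftarrow V}\overset{\sim}{\longleftrightarrow}\mathbf{Mod}_{s_i\cdot\overleftarrow V},\qquad (M,\rho_{\overleftarrow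 V})\longleftrightarrow(M,\rho_{\overleftarrow V}(\mathrm{Id}_M\otimes s_i^{-1})).$$
   Context: $\mathrm{Id}_k=\mathrm{Id}_{V_k}$; $\xi_{k,l}^p$ is $\xi_{k,l}$ applied at tensor positions $p,p+1$; juxtaposition is composition. A rank $r$ braided system in $\mathcal C$ is an ordered family $V_1,\dots,V_r$ with morphisms $\sigma_{i,j}\colon V_i\otimes V_j\to V_j\otimes V_i$, $i\le j$ (not necessarily invertible), satisfying the colored Yang--Baxter equation $(\sigma_{j,k}\otimes \mathrm{Id}_i)(\mathrm{Id}_j\otimes\sigma_{i,k})(\sigma_{i,j}\otimes\mathrm{Id}_k)=(\mathrm{Id}_k\otimes\sigma_{i,j})(\sigma_{i,k}\otimes\mathrm{Id}_j)(\mathrm{Id}_i\otimes\sigma_{j,k})$ on $V_i\otimes V_j\otimes V_k$ for all $i\le j\le k$. A normalized pair is $(\nu_k\colon\mathbf I\to V_k,\epsilon_k\colon V_k\to\mathbf I)$ with $\epsilon_k\nu_k=\mathrm{Id}_{\mathbf I}$. Naturality w.r.t. the units: $\xi_{k,l}(\nu_k\otimes\mathrm{Id}_l)=\mathrm{Id}_l\otimes\nu_k$ and $\xi_{k,l}(\mathrm{Id}_k\otimes\nu_l)=\nu_l\otimes\mathrm{Id}_k$. Braided system of unital associative algebras: algebras $(V_k,\mu_k,\nu_k)$ with unit-natural $\xi_{k,l}$, $k<l$, such that together with $\xi_{k,k}:=\nu_k\otimes\mu_k$ they form a braided system. In this case the object $\overleftarrow V=V_r\otimes\cdots\otimes V_1$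 is a unital associative algebra, called the braided tensor product, with unit $\nu_r\otimes\cdots\otimes\nu_1$ and multiplication $$\mu_{\overleftarrow V}=(\mu_r\otimes\cdots\otimes\mu_1)\,\xi_{1,2}^{2r-2}(\xi_{2,3}^{2r-4}\xi_{1,3}^{2r-3})\cdots(\xi_{r-1,r}^{2}\cdots\xi_{2,r}^{r-1}\xi_{1,r}^{r}).$$ For the permuted system the same formula is used with the permuted family and its braiding. *)

theory Defs
  imports Main "HOL-Combinatorics.Transposition"
begin

record ('o, 'm) cat =
  obj :: "'o set"
  arr :: "'m set"
  src :: "'m \<Rightarrow> 'o"
  trg :: "'m \<Rightarrow> 'o"
  ide :: "'o \<Rightarrow> 'm"
  comp :: "'m \<Rightarrow> 'm \<Rightarrow> 'm"  (infixr "\<cdot>\<index>" 65)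

definition hom :: "('o, 'm, 'x) cat_scheme \<Rightarrow> 'o \<Rightarrow> 'o \<Rightarrow> 'm set" where
  "hom C X Y = {f \<in> arr C. src C f = X \<and> trg C f = Y}"

text \<open>\<open>g \<cdot> f\<close> is \<open>f\<close> followed by \<open>g\<close>; it is unspecified unless the target of \<open>f\<close> is the source of \<open>g\<close>.\<close>

locale category =
  fixes C :: "('o, 'm, 'x) cat_scheme" (structure)
  assumes src_obj: "f \<in> arr C \<Longrightarrow> src C f \<in> obj C"
    and trg_obj: "f \<in> arr C \<Longrightarrow> trg C f \<in> obj C"
    and ide_hom: "X \<in> obj C \<Longrightarrow> ide C X \<in> hom C X X"
    and comp_hom: "\<lbrakk>f \<in> hom C X Y; g \<in> hom C Y Z\<rbrakk> \<Longrightarrow> g \<cdot> f \<in> hom C X Z"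
    and ide_comp: "f \<in> hom C X Y \<Longrightarrow> ide C Y \<cdot> f = f"
    and comp_ide: "f \<in> hom C X Y \<Longrightarrow> f \<cdot> ide C X = f"
    and comp_assoc:
      "\<lbrakk>f \<in> hom C W X; g \<in> hom C X Y; h \<in> hom C Y Z\<rbrakk> \<Longrightarrow> (h \<cdot> g) \<cdot> f = h \<cdot> (g \<cdot> f)"

definition inverse_arrows :: "('o, 'm, 'x) cat_scheme \<Rightarrow> 'm \<Rightarrow> 'm \<Rightarrow> bool" where
  "inverse_arrows C f g \<longleftrightarrow>
     f \<in> arr C \<and> g \<in> hom C (trg C f) (src C f) \<and>
     g \<cdot>\<^bsub>C\<^esub> f = ide C (src C f) \<and> f \<cdot>\<^bsub>C\<^esub> g = ide C (trg C f)"

definition invertible :: "('o, 'm, 'x) cat_scheme \<Rightarrow> 'm \<Rightarrow> bool" where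
  "invertible C f \<longleftrightarrow> (\<exists>g. inverse_arrows C f g)"

definition inv_arr :: "('o, 'm, 'x) cat_scheme \<Rightarrow> 'm \<Rightarrow> 'm" where
  "inv_arr C f = (THE g. inverse_arrows C f g)"

record ('o, 'm, 'p, 'n) func =
  on_obj :: "'o \<Rightarrow> 'p"
  on_arr :: "'m \<Rightarrow> 'n"

locale cat_functor = category C + D: category D
  for C :: "('o, 'm, 'x) cat_scheme" and D :: "('p, 'n, 'y) cat_scheme" +
  fixes F :: "('o, 'm, 'p, 'n) func"
  assumes on_obj: "X \<in> obj C \<Longrightarrow> on_obj F X \<in> obj D"
    and on_arr: "f \<in> hom C X Y \<Longrightarrow> on_arr F f \<in> hom D (on_obj F X) (on_obj F Y)"
    and on_ide: "X \<in> obj C \<Longrightarrow> on_arr F (ide C X) = ide D (on_obj F X)"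
    and on_comp: "\<lbrakk>f \<in> hom C X Y; g \<in> hom C Y Z\<rbrakk>
      \<Longrightarrow> on_arr F (g \<cdot>\<^bsub>C\<^esub> f) = on_arr F g \<cdot>\<^bsub>D\<^esub> on_arr F f"

definition id_func :: "('o, 'm, 'o, 'm) func" where
  "id_func = \<lparr>on_obj = id, on_arr = id\<rparr>"

definition comp_func :: "('p, 'n, 'q, 'k) func \<Rightarrow> ('o, 'm, 'p, 'n) func \<Rightarrow> ('o, 'm, 'q, 'k) func" where
  "comp_func G F = \<lparr>on_obj = on_obj G \<circ> on_obj F, on_arr = on_arr G \<circ> on_arr F\<rparr>"

definition naturally_isomorphic ::
    "('o, 'm, 'x) cat_scheme \<Rightarrow> ('p, 'n, 'y) cat_scheme
      \<Rightarrow> ('o, 'm, 'p, 'n) func \<Rightarrow> ('o, 'm, 'p, 'n) func \<Rightarrow> bool" where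
  "naturally_isomorphic C D F G \<longleftrightarrow> (\<exists>\<eta>.
     (\<forall>X\<in>obj C. \<eta> X \<in> hom D (on_obj F X) (on_obj G X) \<and> invertible D (\<eta> X)) \<and>
     (\<forall>f\<in>arr C. \<eta> (trg C f) \<cdot>\<^bsub>D\<^esub> on_arr F f = on_arr G f \<cdot>\<^bsub>D\<^esub> \<eta> (src C f)))"

definition cat_equivalence ::
    "('o, 'm, 'x) cat_scheme \<Rightarrow> ('p, 'n, 'y) cat_scheme
      \<Rightarrow> ('o, 'm, 'p, 'n) func \<Rightarrow> ('p, 'n, 'o, 'm) func \<Rightarrow> bool" where
  "cat_equivalence C D F G \<longleftrightarrow>
     cat_functor C D F \<and> cat_functor D C G \<and>
     naturally_isomorphic C C (comp_func G F) id_func \<and>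
     naturally_isomorphic D D (comp_func F G) id_func"

record ('o, 'm) moncat = "('o, 'm) cat" +
  unit_obj :: "'o"  ("\<I>\<index>")
  ten_obj :: "'o \<Rightarrow> 'o \<Rightarrow> 'o"  (infixr "\<odot>\<index>" 70)
  ten_arr :: "'m \<Rightarrow> 'm \<Rightarrow> 'm"  (infixr "\<otimes>\<index>" 70)

locale strict_monoidal_category = category C
  for C :: "('o, 'm, 'x) moncat_scheme" (structure) +
  assumes unit_obj: "\<I> \<in> obj C"
    and ten_obj: "\<lbrakk>X \<in> obj C; Y \<in> obj C\<rbrakk> \<Longrightarrow> X \<odot> Y \<in> obj C"
    and ten_hom: "\<lbrakk>f \<in> hom C X X'; g \<in> hom C Y Y'\<rbrakk> \<Longrightarrow> f \<otimes> g \<in> hom C (X \<odot> Y) (X' \<odot> Y')"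
    and ten_ide: "\<lbrakk>X \<in> obj C; Y \<in> obj C\<rbrakk> \<Longrightarrow> ide C X \<otimes> ide C Y = ide C (X \<odot> Y)"
    and interchange:
      "\<lbrakk>f \<in> hom C X X'; f' \<in> hom C X' X''; g \<in> hom C Y Y'; g' \<in> hom C Y' Y''\<rbrakk>
        \<Longrightarrow> (f' \<cdot> f) \<otimes> (g' \<cdot> g) = (f' \<otimes> g') \<cdot> (f \<otimes> g)"
    and ten_obj_assoc:
      "\<lbrakk>X \<in> obj C; Y \<in> obj C; Z \<in> obj C\<rbrakk> \<Longrightarrow> (X \<odot> Y) \<odot> Z = X \<odot> (Y \<odot> Z)"
    and ten_arr_assoc:
      "\<lbrakk>f \<in> arr C; g \<in> arr C; h \<in> arr C\<rbrakk> \<Longrightarrow> (f \<otimes> g) \<otimes> h = f \<otimes> (g \<otimes> h)"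
    and unit_ten_obj: "X \<in> obj C \<Longrightarrow> \<I> \<odot> X = X"
    and ten_obj_unit: "X \<in> obj C \<Longrightarrow> X \<odot> \<I> = X"
    and unit_ten_arr: "f \<in> arr C \<Longrightarrow> ide C \<I> \<otimes> f = f"
    and ten_arr_unit: "f \<in> arr C \<Longrightarrow> f \<otimes> ide C \<I> = f"

definition ten_obj_list :: "('o, 'm, 'x) moncat_scheme \<Rightarrow> 'o list \<Rightarrow> 'o" where
  "ten_obj_list C Xs = foldr (ten_obj C) Xs \<I>\<^bsub>C\<^esub>"

definition ten_arr_list :: "('o, 'm, 'x) moncat_scheme \<Rightarrow> 'm list \<Rightarrow> 'm" where
  "ten_arr_list C fs = foldr (ten_arr C) fs (ide C \<I>\<^bsub>C\<^esub>)"

record ('o, 'm) alg =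
  carr :: "'o"
  mul :: "'m"
  unt :: "'m"

locale unital_algebra = strict_monoidal_category C
  for C :: "('o, 'm, 'x) moncat_scheme" (structure) +
  fixes A :: "('o, 'm) alg"
  assumes carr_obj: "carr A \<in> obj C"
    and mul_hom: "mul A \<in> hom C (carr A \<odot> carr A) (carr A)"
    and unt_hom: "unt A \<in> hom C \<I> (carr A)"
    and mul_assoc: "mul A \<cdot> (mul A \<otimes> ide C (carr A)) = mul A \<cdot> (ide C (carr A) \<otimes> mul A)"
    and unt_mul: "mul A \<cdot> (unt A \<otimes> ide C (carr A)) = ide C (carr A)"
    and mul_unt: "mul A \<cdot> (ide C (carr A) \<otimes> unt A) = ide C (carr A)"

locale algebra_hom = unital_algebra C A + B: unital_algebra C B
  for C :: "('o, 'm, 'x) moncat_scheme" (structure) and A B +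
  fixes f :: "'m"
  assumes hom: "f \<in> hom C (carr A) (carr B)"
    and hom_mul: "f \<cdot> mul A = mul B \<cdot> (f \<otimes> f)"
    and hom_unt: "f \<cdot> unt A = unt B"

definition algebra_iso ::
    "('o, 'm, 'x) moncat_scheme \<Rightarrow> ('o, 'm) alg \<Rightarrow> ('o, 'm) alg \<Rightarrow> 'm \<Rightarrow> bool" where
  "algebra_iso C A B f \<longleftrightarrow>
     algebra_hom C A B f \<and> (\<exists>g. algebra_hom C B A g \<and> inverse_arrows C f g)"

definition right_module :: "('o, 'm, 'x) moncat_scheme \<Rightarrow> ('o, 'm) alg \<Rightarrow> 'o \<times> 'm \<Rightarrow> bool" where
  "right_module C A = (\<lambda>(M, \<rho>).
     M \<in> obj C \<and> \<rho> \<in> hom C (M \<odot>\<^bsub>C\<^esub> carr A) M \<and>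
     \<rho> \<cdot>\<^bsub>C\<^esub> (\<rho> \<otimes>\<^bsub>C\<^esub> ide C (carr A)) = \<rho> \<cdot>\<^bsub>C\<^esub> (ide C M \<otimes>\<^bsub>C\<^esub> mul A) \<and>
     \<rho> \<cdot>\<^bsub>C\<^esub> (ide C M \<otimes>\<^bsub>C\<^esub> unt A) = ide C M)"

definition module_hom ::
    "('o, 'm, 'x) moncat_scheme \<Rightarrow> ('o, 'm) alg \<Rightarrow> 'o \<times> 'm \<Rightarrow> 'o \<times> 'm \<Rightarrow> 'm \<Rightarrow> bool" where
  "module_hom C A = (\<lambda>(M, \<rho>) (N, \<tau>) f.
     f \<in> hom C M N \<and> f \<cdot>\<^bsub>C\<^esub> \<rho> = \<tau> \<cdot>\<^bsub>C\<^esub> (f \<otimes>\<^bsub>C\<^esub> ide C (carr A)))"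

text \<open>A morphism of modules is stored together with its source and target, since the same
  morphism of \<open>C\<close> can be linear for several pairs of actions.\<close>

definition Mod :: "('o, 'm, 'x) moncat_scheme \<Rightarrow> ('o, 'm) alg
    \<Rightarrow> ('o \<times> 'm, ('o \<times> 'm) \<times> ('o \<times> 'm) \<times> 'm) cat" where
  "Mod C A =
     \<lparr>obj = {P. right_module C A P},
      arr = {(P, Q, f). right_module C A P \<and> right_module C A Q \<and> module_hom C A P Q f},
      src = (\<lambda>(P, Q, f). P),
      trg = (\<lambda>(P, Q, f). Q),
      ide = (\<lambda>P. (P, P, ide C (fst P))),
      comp = (\<lambda>(P', Q', g) (P, Q, f). (P, Q', g \<cdot>\<^bsub>C\<^esub> f))\<rparr>"

definition pull_action :: "('o, 'm, 'x) moncat_scheme \<Rightarrow> 'm \<Rightarrow> 'o \<times> 'm \<Rightarrow> 'o \<times> 'm" where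
  "pull_action C f = (\<lambda>(M, \<rho>). (M, \<rho> \<cdot>\<^bsub>C\<^esub> (ide C M \<otimes>\<^bsub>C\<^esub> f)))"

definition restrict_scalars :: "('o, 'm, 'x) moncat_scheme \<Rightarrow> 'm
    \<Rightarrow> ('o \<times> 'm, ('o \<times> 'm) \<times> ('o \<times> 'm) \<times> 'm, 'o \<times> 'm, ('o \<times> 'm) \<times> ('o \<times> 'm) \<times> 'm) func" where
  "restrict_scalars C f =
     \<lparr>on_obj = pull_action C f,
      on_arr = (\<lambda>(P, Q, h). (pull_action C f P, pull_action C f Q, h))\<rparr>"

text \<open>Families are indexed by \<open>1, \<dots>, r\<close>; their values at other indices are irrelevant, and so
  are those of \<open>\<sigma>\<close> and \<open>\<xi>\<close> at pairs outside the stated range.\<close>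

locale braided_system = strict_monoidal_category C
  for C :: "('o, 'm, 'x) moncat_scheme" (structure) +
  fixes r :: nat and V :: "nat \<Rightarrow> 'o" and \<sigma> :: "nat \<Rightarrow> nat \<Rightarrow> 'm"
  assumes V_obj: "\<lbrakk>1 \<le> k; k \<le> r\<rbrakk> \<Longrightarrow> V k \<in> obj C"
    and \<sigma>_hom: "\<lbrakk>1 \<le> i; i \<le> j; j \<le> r\<rbrakk> \<Longrightarrow> \<sigma> i j \<in> hom C (V i \<odot> V j) (V j \<odot> V i)"
    and yang_baxter: "\<lbrakk>1 \<le> i; i \<le> j; j \<le> k; k \<le> r\<rbrakk> \<Longrightarrow>
      (\<sigma> j k \<otimes> ide C (V i)) \<cdot> (ide C (V j) \<otimes> \<sigma> i k) \<cdot> (\<sigma> i j \<otimes> ide C (V k))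
      = (ide C (V k) \<otimes> \<sigma> i j) \<cdot> (\<sigma> i k \<otimes> ide C (V j)) \<cdot> (ide C (V i) \<otimes> \<sigma> j k)"

definition normalized_pair :: "('o, 'm, 'x) moncat_scheme \<Rightarrow> 'o \<Rightarrow> 'm \<Rightarrow> 'm \<Rightarrow> bool" where
  "normalized_pair C X \<nu> \<epsilon> \<longleftrightarrow>
     \<nu> \<in> hom C \<I>\<^bsub>C\<^esub> X \<and> \<epsilon> \<in> hom C X \<I>\<^bsub>C\<^esub> \<and> \<epsilon> \<cdot>\<^bsub>C\<^esub> \<nu> = ide C \<I>\<^bsub>C\<^esub>"

definition with_diagonal ::
    "('o, 'm, 'x) moncat_scheme \<Rightarrow> (nat \<Rightarrow> ('o, 'm) alg) \<Rightarrow> (nat \<Rightarrow> nat \<Rightarrow> 'm) \<Rightarrow> nat \<Rightarrow> nat \<Rightarrow> 'm" where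
  "with_diagonal C A \<xi> k l = (if k = l then unt (A k) \<otimes>\<^bsub>C\<^esub> mul (A k) else \<xi> k l)"

locale braided_system_of_algebras = strict_monoidal_category C
  for C :: "('o, 'm, 'x) moncat_scheme" (structure) +
  fixes r :: nat and A :: "nat \<Rightarrow> ('o, 'm) alg" and \<xi> :: "nat \<Rightarrow> nat \<Rightarrow> 'm"
  assumes algebras: "\<lbrakk>1 \<le> k; k \<le> r\<rbrakk> \<Longrightarrow> unital_algebra C (A k)"
    and \<xi>_hom: "\<lbrakk>1 \<le> k; k < l; l \<le> r\<rbrakk> \<Longrightarrow>
      \<xi> k l \<in> hom C (carr (A k) \<odot> carr (A l)) (carr (A l) \<odot> carr (A k))"
    and natural_unt_left: "\<lbrakk>1 \<le> k; k < l; l \<le> r\<rbrakk> \<Longrightarrow>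
      \<xi> k l \<cdot> (unt (A k) \<otimes> ide C (carr (A l))) = ide C (carr (A l)) \<otimes> unt (A k)"
    and natural_unt_right: "\<lbrakk>1 \<le> k; k < l; l \<le> r\<rbrakk> \<Longrightarrow>
      \<xi> k l \<cdot> (ide C (carr (A k)) \<otimes> unt (A l)) = unt (A l) \<otimes> ide C (carr (A k))"
    and braided: "braided_system C r (\<lambda>k. carr (A k)) (with_diagonal C A \<xi>)"

text \<open>The superscript in \<open>\<xi>\<^sub>k\<^sub>,\<^sub>l\<^sup>p\<close> suppresses the remaining tensor factors. They are recovered by
  keeping track of the word \<open>w\<close> of indices of the current tensor product:
  \<open>at_position C V f p w\<close> is the morphism \<open>f\<close> applied at the tensor positions \<open>p, p + 1\<close>
  (counted from 1) of the product \<open>V w\<^sub>1 \<otimes> V w\<^sub>2 \<otimes> \<dots>\<close>.\<close>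

definition at_position ::
    "('o, 'm, 'x) moncat_scheme \<Rightarrow> (nat \<Rightarrow> 'o) \<Rightarrow> 'm \<Rightarrow> nat \<Rightarrow> nat list \<Rightarrow> 'm" where
  "at_position C V f p w = ten_arr_list C
     (map (\<lambda>k. ide C (V k)) (take (p - 1) w) @ [f] @ map (\<lambda>k. ide C (V k)) (drop (p + 1) w))"

text \<open>\<open>crossings C V \<xi> ss w\<close> is the composite of the \<open>\<xi>\<^sub>k\<^sub>,\<^sub>l\<^sup>p\<close> for \<open>(k, l, p)\<close> in \<open>ss\<close>, starting from
  the product with index word \<open>w\<close>. The head of \<open>ss\<close> is applied first, so that \<open>ss\<close> lists the
  factors of the composite from right to left. After the step \<open>(k, l, p)\<close> the letters at the
  positions \<open>p, p + 1\<close>, which were \<open>k, l\<close>, have become \<open>l, k\<close>.\<close>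

fun crossings :: "('o, 'm, 'x) moncat_scheme \<Rightarrow> (nat \<Rightarrow> 'o) \<Rightarrow> (nat \<Rightarrow> nat \<Rightarrow> 'm)
    \<Rightarrow> (nat \<times> nat \<times> nat) list \<Rightarrow> nat list \<Rightarrow> 'm" where
  "crossings C V \<xi> [] w = ide C (ten_obj_list C (map V w))"
| "crossings C V \<xi> ((k, l, p) # ss) w =
     crossings C V \<xi> ss (take (p - 1) w @ [l, k] @ drop (p + 1) w)
       \<cdot>\<^bsub>C\<^esub> at_position C V (\<xi> k l) p w"

text \<open>The factors of
  \<open>\<xi>\<^sub>1\<^sub>,\<^sub>2\<^sup>2\<^sup>r\<^sup>-\<^sup>2 (\<xi>\<^sub>2\<^sub>,\<^sub>3\<^sup>2\<^sup>r\<^sup>-\<^sup>4 \<xi>\<^sub>1\<^sub>,\<^sub>3\<^sup>2\<^sup>r\<^sup>-\<^sup>3) \<dots> (\<xi>\<^sub>r\<^sub>-\<^sub>1\<^sub>,\<^sub>r\<^sup>2 \<dots> \<xi>\<^sub>2\<^sub>,\<^sub>r\<^sup>r\<^sup>-\<^sup>1 \<xi>\<^sub>1\<^sub>,\<^sub>r\<^sup>r)\<close> from right to left;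
  the exponent of \<open>\<xi>\<^sub>k\<^sub>,\<^sub>l\<close> is \<open>2r - k - l + 1\<close>.\<close>

definition unshuffle :: "nat \<Rightarrow> (nat \<times> nat \<times> nat) list" where
  "unshuffle r = [(k, l, 2 * r + 1 - k - l). l \<leftarrow> rev [2..<r + 1], k \<leftarrow> [1..<l]]"

definition braided_tensor_product :: "('o, 'm, 'x) moncat_scheme \<Rightarrow> nat
    \<Rightarrow> (nat \<Rightarrow> ('o, 'm) alg) \<Rightarrow> (nat \<Rightarrow> nat \<Rightarrow> 'm) \<Rightarrow> ('o, 'm) alg" where
  "braided_tensor_product C r A \<xi> =
     (let w = rev [1..<r + 1] in
      \<lparr>carr = ten_obj_list C (map (\<lambda>k. carr (A k)) w),
       mul = ten_arr_list C (map (\<lambda>k. mul (A k)) w)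
               \<cdot>\<^bsub>C\<^esub> crossings C (\<lambda>k. carr (A k)) \<xi> (unshuffle r) (w @ w),
       unt = ten_arr_list C (map (\<lambda>k. unt (A k)) w)\<rparr>)"

definition swap_family :: "nat \<Rightarrow> (nat \<Rightarrow> 'a) \<Rightarrow> nat \<Rightarrow> 'a" where
  "swap_family i A k = A (transpose i (i + 1) k)"

definition swap_braiding ::
    "('o, 'm, 'x) moncat_scheme \<Rightarrow> nat \<Rightarrow> (nat \<Rightarrow> nat \<Rightarrow> 'm) \<Rightarrow> nat \<Rightarrow> nat \<Rightarrow> 'm" where
  "swap_braiding C i \<xi> k l =
     (if k = i \<and> l = i + 1 then inv_arr C (\<xi> i (i + 1))
      else \<xi> (transpose i (i + 1) k) (transpose i (i + 1) l))"

definition swap_arrow :: "('o, 'm, 'x) moncat_scheme \<Rightarrow> nat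
    \<Rightarrow> (nat \<Rightarrow> 'o) \<Rightarrow> (nat \<Rightarrow> nat \<Rightarrow> 'm) \<Rightarrow> nat \<Rightarrow> 'm" where
  "swap_arrow C r V \<xi> i = ten_arr_list C
     (map (\<lambda>k. ide C (V k)) (rev [i + 2..<r + 1]) @ [inv_arr C (\<xi> i (i + 1))]
      @ map (\<lambda>k. ide C (V k)) (rev [1..<i]))"

end

theory Submission
  imports Defs
begin

text \<open>The multiplication of \<open>V\<^sub>r \<otimes> \<dots> \<otimes> V\<^sub>1\<close> can be built one factor at a time. For two algebras
  \<open>A\<close>, \<open>B\<close>, a morphism \<open>\<tau> : A \<otimes> B \<rightarrow> B \<otimes> A\<close> compatible with both units and both multiplications
  (a distributive law, locale \<open>twisting\<close>) turns \<open>B \<otimes> A\<close> into an algebra with multiplication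
  \<open>(\<mu>\<^sub>B \<otimes> \<mu>\<^sub>A) (B \<otimes> \<tau> \<otimes> A)\<close>, the \<open>twisted_product\<close>. Everything reduces to such pairs.

  Since \<open>\<sigma>\<^sub>k\<^sub>k = \<nu>\<^sub>k \<otimes> \<mu>\<^sub>k\<close>, the Yang--Baxter equation on \<open>V\<^sub>k \<otimes> V\<^sub>k \<otimes> V\<^sub>l\<close> says, given naturality with
  respect to the units, that \<open>\<xi>\<^sub>k\<^sub>l\<close> is compatible with \<open>\<mu>\<^sub>k\<close>, and the one on \<open>V\<^sub>k \<otimes> V\<^sub>l \<otimes> V\<^sub>l\<close> says
  the same about \<open>\<mu>\<^sub>l\<close>; on \<open>V\<^sub>k \<otimes> V\<^sub>k \<otimes> V\<^sub>k\<close> it always holds, by associativity. So a braided system of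
  algebras is a family of algebras with a twisting for every pair \<open>k < l\<close> and the Yang--Baxter
  equation for every triple \<open>k < l < m\<close> (\<open>braided_system_of_algebras_iff\<close>). In this form the first part
  is clear: the inverse of a twisting is a twisting (\<open>twisting_inverse\<close>), and in a Yang--Baxter
  equation an invertible first or last crossing may be moved to the other side.

  The braided tensor product is an iterated twisted product: \<open>V\<^sub>n\<^sub>+\<^sub>1\<close> is twisted with
  \<open>V\<^sub>n \<otimes> \<dots> \<otimes> V\<^sub>1\<close> along the composite of \<open>\<xi>\<^sub>1\<^sub>,\<^sub>n\<^sub>+\<^sub>1, \<dots>, \<xi>\<^sub>n\<^sub>,\<^sub>n\<^sub>+\<^sub>1\<close>, because the crossings of the formula for
  the multiplication first bring the second \<open>V\<^sub>n\<^sub>+\<^sub>1\<close> to the first one and then act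
  on the remaining factors (\<open>braided_tensor_product_eq_product\<close>). Composites of twistings are
  twistings by the Yang--Baxter equation (\<open>twisting_twisted_product\<close>), so these are algebras.

  That \<open>s\<close> is a homomorphism is shown by induction on the number of factors. With \<open>i + 1\<close> factors,
  twisted products are associative, with equality and not only isomorphism (\<open>twisted_product_assoc\<close>), so that both products have the form
  of a pair \<open>V\<^sub>i\<^sub>+\<^sub>1 \<otimes> V\<^sub>i\<close> or \<open>V\<^sub>i \<otimes> V\<^sub>i\<^sub>+\<^sub>1\<close> twisted with the same algebra, and the claim reduces to
  \<open>\<xi>\<^sub>i\<^sub>,\<^sub>i\<^sub>+\<^sub>1\<^sup>-\<^sup>1\<close> being a homomorphism between twisted products of two algebras (\<open>inverse_hom\<close>). Each further
  factor only requires that \<open>s\<close> commutes with the twistings, which is again a Yang--Baxter equation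
  (\<open>passing_swap_natural\<close>). Finally, restriction of scalars along two mutually inverse homomorphisms
  gives functors that are inverse to each other on the nose.\<close>

section \<open>Rewriting composites in a strict monoidal category\<close>

text \<open>Equations between composites of tensor products are proved by rewriting with typed arrows. Typing is
  expressed by \<open>src\<close> and \<open>trg\<close> instead of hom-sets, so that the simplifier computes sources and targets and
  discharges all side conditions. The simplification rules bring every composite into a right-nested
  sequence of \<^emph>\<open>layers\<close> \<open>Id\<^sub>L \<otimes> f \<otimes> Id\<^sub>R\<close>, each with a single arrow \<open>f\<close> that is not an identity. What
  remains to be supplied in each proof is the list of interchange moves between neighbouring layers
  (lemma \<open>slide\<close>) and of the defining relations used, each placed in its context.\<close>

context category begin

lemma hom_iff: "f \<in> hom C X Y \<longleftrightarrow> f \<in> arr C \<and> src C f = X \<and> trg C f = Y"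
  by (simp add: hom_def)

lemma ide_simps [simp]:
  assumes "X \<in> obj C"
  shows "ide C X \<in> arr C" "src C (ide C X) = X" "trg C (ide C X) = X"
  using ide_hom[OF assms] by (auto simp: hom_iff)

lemma comp_simps [simp]:
  assumes "f \<in> arr C" "g \<in> arr C" "src C g = trg C f"
  shows "g \<cdot> f \<in> arr C" "src C (g \<cdot> f) = src C f" "trg C (g \<cdot> f) = trg C g"
  using comp_hom[of f "src C f" "trg C f" g "trg C g"] assms by (auto simp: hom_iff)

lemma ide_comp_arr [simp]: "f \<in> arr C \<Longrightarrow> trg C f = X \<Longrightarrow> ide C X \<cdot> f = f"
  by (simp add: ide_comp[of f "src C f"] hom_iff)

lemma comp_ide_arr [simp]: "f \<in> arr C \<Longrightarrow> src C f = X \<Longrightarrow> f \<cdot> ide C X = f"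
  by (simp add: comp_ide[of f _ "trg C f"] hom_iff)

lemma comp_assoc_arr [simp]:
  assumes "f \<in> arr C" "g \<in> arr C" "h \<in> arr C" "src C g = trg C f" "src C h = trg C g"
  shows "(h \<cdot> g) \<cdot> f = h \<cdot> g \<cdot> f"
  by (rule comp_assoc[of f "src C f" "src C g" g "src C h" h "trg C h"]) (use assms in \<open>auto simp: hom_iff\<close>)

text \<open>In a right-nested composite the arrows \<open>g\<close> and \<open>f\<close> of a relation \<open>g \<cdot> f = k\<close> are usually followed by a
  further arrow, so that the left-hand side does not occur literally; the two lemmas below provide the
  rewrite rule for this situation, for relations with two and with three factors on the left.\<close>

lemma chain_eq:
  assumes "g \<cdot> f = k" "f \<in> arr C" "g \<in> arr C" "src C g = trg C f" "h \<in> arr C" "trg C h = src C f"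
  shows "g \<cdot> f \<cdot> h = k \<cdot> h"
  using assms comp_assoc_arr[of h f g] by auto

lemma chain3_eq:
  assumes "g \<cdot> f \<cdot> e = k" "e \<in> arr C" "f \<in> arr C" "g \<in> arr C" "src C f = trg C e" "src C g = trg C f"
    "h \<in> arr C" "trg C h = src C e"
  shows "g \<cdot> f \<cdot> e \<cdot> h = k \<cdot> h"
  using assms comp_assoc_arr[of h "f \<cdot> e" g] by auto

declare src_obj [simp] trg_obj [simp]

end

context strict_monoidal_category begin

declare unit_obj [simp] ten_obj [simp] ten_obj_assoc [simp] unit_ten_obj [simp] ten_obj_unit [simp]
  unit_ten_arr [simp] ten_arr_unit [simp] ten_arr_assoc [simp] ten_ide [simp]

lemma ten_simps [simp]:
  assumes "f \<in> arr C" "g \<in> arr C"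
  shows "f \<otimes> g \<in> arr C" "src C (f \<otimes> g) = src C f \<odot> src C g" "trg C (f \<otimes> g) = trg C f \<odot> trg C g"
  using ten_hom[of f "src C f" "trg C f" g "src C g" "trg C g"] assms by (auto simp: hom_iff)

lemma ten_ide_ten [simp]:
  "X \<in> obj C \<Longrightarrow> Y \<in> obj C \<Longrightarrow> f \<in> arr C \<Longrightarrow> ide C X \<otimes> ide C Y \<otimes> f = ide C (X \<odot> Y) \<otimes> f"
  by (simp add: ten_arr_assoc[symmetric] del: ten_arr_assoc)

lemma interchange_arr:
  assumes "f \<in> arr C" "f' \<in> arr C" "g \<in> arr C" "g' \<in> arr C" "src C f' = trg C f" "src C g' = trg C g"
  shows "(f' \<cdot> f) \<otimes> (g' \<cdot> g) = (f' \<otimes> g') \<cdot> (f \<otimes> g)"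
  by (rule interchange) (use assms in \<open>auto simp: hom_iff\<close>)

lemma whisker_left [simp]:
  assumes "f \<in> arr C" "g \<in> arr C" "src C g = trg C f" "X \<in> obj C"
  shows "ide C X \<otimes> (g \<cdot> f) = (ide C X \<otimes> g) \<cdot> (ide C X \<otimes> f)"
  using interchange_arr[of "ide C X" "ide C X" f g] assms by simp

lemma whisker_right [simp]:
  assumes "f \<in> arr C" "g \<in> arr C" "src C g = trg C f" "X \<in> obj C"
  shows "(g \<cdot> f) \<otimes> ide C X = (g \<otimes> ide C X) \<cdot> (f \<otimes> ide C X)"
  using interchange_arr[of f g "ide C X" "ide C X"] assms by simp

text \<open>The two ways of writing \<open>f \<otimes> g\<close> as two layers. They are not simplification rules, as they would also
  split layers; the proofs instantiate \<open>ten_split\<close> for the products that occur in them.\<close>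

lemma ten_split:
  assumes "f \<in> arr C" "g \<in> arr C"
  shows "f \<otimes> g = (f \<otimes> ide C (trg C g)) \<cdot> (ide C (src C f) \<otimes> g)"
  using interchange_arr[of "ide C (src C f)" f g "ide C (trg C g)"] assms by simp

lemma ten_split':
  assumes "f \<in> arr C" "g \<in> arr C"
  shows "f \<otimes> g = (ide C (trg C f) \<otimes> g) \<cdot> (f \<otimes> ide C (src C g))"
  using interchange_arr[of f "ide C (trg C f)" "ide C (src C g)" g] assms by simp

lemma ten_comp_left:
  assumes "f \<in> arr C" "g \<in> arr C" "h \<in> arr C" "src C h = trg C g"
  shows "f \<otimes> (h \<cdot> g) = (f \<otimes> h) \<cdot> (ide C (src C f) \<otimes> g)"
  using interchange_arr[of "ide C (src C f)" f g h] assms by simp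

lemma ten_comp_right:
  assumes "f \<in> arr C" "g \<in> arr C" "h \<in> arr C" "src C h = trg C g"
  shows "(h \<cdot> g) \<otimes> f = (h \<otimes> f) \<cdot> (g \<otimes> ide C (src C f))"
  using interchange_arr[of g h "ide C (src C f)" f] assms by simp

text \<open>Interchange of two layers. The equation is oriented so that the arrow further to the left in the
  tensor product moves to the outermost position; if all instances are used in this direction, sequences
  that differ only by interchange get the same form.\<close>

lemma slide:
  assumes "L \<in> obj C" "f \<in> arr C" "M \<in> obj C" "g \<in> arr C" "R \<in> obj C"
  shows "(ide C (L \<odot> trg C f \<odot> M) \<otimes> g \<otimes> ide C R) \<cdot> (ide C L \<otimes> f \<otimes> ide C (M \<odot> src C g \<odot> R))
       = (ide C L \<otimes> f \<otimes> ide C (M \<odot> trg C g \<odot> R)) \<cdot> (ide C (L \<odot> src C f \<odot> M) \<otimes> g \<otimes> ide C R)"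
proof -
  have "(ide C (trg C f) \<otimes> (ide C M \<otimes> g \<otimes> ide C R)) \<cdot> (f \<otimes> ide C (M \<odot> src C g \<odot> R))
     = (f \<otimes> ide C (M \<odot> trg C g \<odot> R)) \<cdot> (ide C (src C f) \<otimes> (ide C M \<otimes> g \<otimes> ide C R))"
    using ten_split[of f "ide C M \<otimes> g \<otimes> ide C R"] ten_split'[of f "ide C M \<otimes> g \<otimes> ide C R"] assms
    by simp
  from arg_cong[OF this, of "\<lambda>z. ide C L \<otimes> z"] show ?thesis using assms by simp
qed

lemma in_context: "u = v \<Longrightarrow> ide C L \<otimes> u \<otimes> ide C R = ide C L \<otimes> v \<otimes> ide C R" by simp

end

lemma (in category) inverse_arrows_unique:
  assumes "inverse_arrows C f g" "inverse_arrows C f g'"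
  shows "g = g'"
proof -
  have "g = (g' \<cdot> f) \<cdot> g" using assms by (auto simp: inverse_arrows_def hom_iff)
  also have "\<dots> = g' \<cdot> f \<cdot> g" by (rule comp_assoc_arr) (use assms in \<open>auto simp: inverse_arrows_def hom_iff\<close>)
  also have "\<dots> = g'" using assms by (auto simp: inverse_arrows_def hom_iff)
  finally show ?thesis .
qed

lemma (in category) inv_arr_eq: "inverse_arrows C f g \<Longrightarrow> inv_arr C f = g"
  unfolding inv_arr_def using inverse_arrows_unique by blast

lemma (in category) inverse_arrows_inv_arr: "invertible C f \<Longrightarrow> inverse_arrows C f (inv_arr C f)"
  unfolding invertible_def using inv_arr_eq by blast

lemma (in strict_monoidal_category) inverse_arrows_ten:
  assumes "inverse_arrows C f f'" "inverse_arrows C g g'"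
  shows "inverse_arrows C (f \<otimes> g) (f' \<otimes> g')"
  using assms interchange_arr[of f f' g g'] interchange_arr[of f' f g' g]
  by (auto simp: inverse_arrows_def hom_iff)

lemma (in category) inverse_arrows_ide: "X \<in> obj C \<Longrightarrow> inverse_arrows C (ide C X) (ide C X)"
  by (simp add: inverse_arrows_def hom_iff)

section \<open>Twisted tensor products of two algebras\<close>

context unital_algebra begin
declare carr_obj [simp]
lemma algebra_simps [simp]:
  "mul A \<in> arr C" "src C (mul A) = carr A \<odot> carr A" "trg C (mul A) = carr A"
  "unt A \<in> arr C" "src C (unt A) = \<I>" "trg C (unt A) = carr A"
  using mul_hom unt_hom by (auto simp: hom_iff)
end

text \<open>The conditions say that \<open>A\<close>, with its algebra structure, can be moved past \<open>B\<close>, and conversely: this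
  is a distributive law between the monads \<open>- \<otimes> A\<close> and \<open>- \<otimes> B\<close>.\<close>

locale twisting = strict_monoidal_category C + A: unital_algebra C A + B: unital_algebra C B
  for C :: "('o, 'm, 'x) moncat_scheme" (structure) and A B +
  fixes \<tau> :: 'm
  assumes twist_hom: "\<tau> \<in> hom C (carr A \<odot> carr B) (carr B \<odot> carr A)"
    and unt_left: "\<tau> \<cdot> (unt A \<otimes> ide C (carr B)) = ide C (carr B) \<otimes> unt A"
    and unt_right: "\<tau> \<cdot> (ide C (carr A) \<otimes> unt B) = unt B \<otimes> ide C (carr A)"
    and mul_left: "\<tau> \<cdot> (mul A \<otimes> ide C (carr B))
      = (ide C (carr B) \<otimes> mul A) \<cdot> (\<tau> \<otimes> ide C (carr A)) \<cdot> (ide C (carr A) \<otimes> \<tau>)"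
    and mul_right: "\<tau> \<cdot> (ide C (carr A) \<otimes> mul B)
      = (mul B \<otimes> ide C (carr A)) \<cdot> (ide C (carr B) \<otimes> \<tau>) \<cdot> (\<tau> \<otimes> ide C (carr B))"
begin
lemma twist_simps [simp]: "\<tau> \<in> arr C" "src C \<tau> = carr A \<odot> carr B" "trg C \<tau> = carr B \<odot> carr A"
  using twist_hom by (auto simp: hom_iff)
end

definition twisted_product ::
    "('o, 'm, 'x) moncat_scheme \<Rightarrow> ('o, 'm) alg \<Rightarrow> ('o, 'm) alg \<Rightarrow> 'm \<Rightarrow> ('o, 'm) alg" where
  "twisted_product C A B \<tau> = \<lparr>carr = carr B \<odot>\<^bsub>C\<^esub> carr A,
    mul = (mul B \<otimes>\<^bsub>C\<^esub> mul A) \<cdot>\<^bsub>C\<^esub> (ide C (carr B) \<otimes>\<^bsub>C\<^esub> \<tau> \<otimes>\<^bsub>C\<^esub> ide C (carr A)),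
    unt = unt B \<otimes>\<^bsub>C\<^esub> unt A\<rparr>"

lemma twisted_product_simps [simp]:
  "carr (twisted_product C A B \<tau>) = carr B \<odot>\<^bsub>C\<^esub> carr A"
  "mul (twisted_product C A B \<tau>) = (mul B \<otimes>\<^bsub>C\<^esub> mul A) \<cdot>\<^bsub>C\<^esub> (ide C (carr B) \<otimes>\<^bsub>C\<^esub> \<tau> \<otimes>\<^bsub>C\<^esub> ide C (carr A))"
  "unt (twisted_product C A B \<tau>) = unt B \<otimes>\<^bsub>C\<^esub> unt A"
  by (simp_all add: twisted_product_def)

context twisting begin

text \<open>Associativity: in both bracketings the distributive laws move all factors \<open>B\<close> to the left of all factors
  \<open>A\<close> first, by the same three crossings, after which associativity of \<open>A\<close> and of \<open>B\<close> applies separately.\<close>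

lemma twisted_product_algebra: "unital_algebra C (twisted_product C A B \<tau>)"
proof
  let ?a = "carr A" and ?b = "carr B" and ?T = "twisted_product C A B \<tau>"
  show "carr ?T \<in> obj C" by simp
  show "mul ?T \<in> hom C (carr ?T \<odot> carr ?T) (carr ?T)" "unt ?T \<in> hom C \<I> (carr ?T)"
    by (simp_all add: hom_iff)
  note split = ten_split[of "mul B" "mul A"] ten_split[of "unt B" "unt A"]
  show "mul ?T \<cdot> (mul ?T \<otimes> ide C (carr ?T)) = mul ?T \<cdot> (ide C (carr ?T) \<otimes> mul ?T)"
  proof -
    \<comment> \<open>interchange moves, then the distributive laws, then associativity of the two factors\<close>
    note R =
      slide[of \<I> "mul B" \<I> \<tau> "?a", simplified]
      slide[of \<I> "mul B" ?b "mul A" "\<I>", simplified]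
      slide[of \<I> "mul B" "?b \<odot> ?a" "mul A" "\<I>", simplified]
      slide[of "?b" "mul B" \<I> "mul A" "\<I>", simplified]
      slide[of "?b" "mul B" ?a "mul A" "\<I>", simplified]
      slide[of "?b" "\<tau>" \<I> "\<tau>" "?a", simplified]
      slide[of "?b" "\<tau>" ?a "mul A" "\<I>", simplified]
      slide[of "?b\<odot>?b" "\<tau>" \<I> "mul A" "\<I>", simplified]
      in_context[OF mul_left, of "?b\<odot>?b" "?a", simplified]
      in_context[OF mul_right, of "?b" "?a", simplified]
      slide[of "?b" "\<tau>" ?b "mul A" "\<I>", simplified]
      in_context[OF A.mul_assoc, of "?b \<odot> ?b \<odot> ?b" "\<I>", simplified]
      in_context[OF B.mul_assoc, of "\<I>" "?a", simplified]
    show ?thesis by (simp add: split R R[THEN chain_eq])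
  qed
  show "mul ?T \<cdot> (unt ?T \<otimes> ide C (carr ?T)) = ide C (carr ?T)"
  proof -
    note R = slide[of \<I> "unt B" \<I> \<tau> "?a", simplified]
      slide[of \<I> "unt B" ?b "mul A" \<I>, simplified]
      in_context[OF unt_left, of \<I> "?a", simplified]
      in_context[OF A.unt_mul, of "?b" "\<I>", simplified]
      in_context[OF B.unt_mul, of "\<I>" "?a", simplified]
    show ?thesis by (simp add: split R R[THEN chain_eq])
  qed
  show "mul ?T \<cdot> (ide C (carr ?T) \<otimes> unt ?T) = ide C (carr ?T)"
  proof -
    note R = slide[of ?b "unt B" \<I> "mul A" \<I>, simplified]
      in_context[OF unt_right, of ?b "?a", simplified]
      in_context[OF A.mul_unt, of "?b" "\<I>", simplified]
      in_context[OF B.mul_unt, of "\<I>" "?a", simplified]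
    show ?thesis by (simp add: split R R[THEN chain_eq])
  qed
qed

text \<open>Each law for \<open>\<chi>\<close> is the corresponding law for \<open>\<tau>\<close> composed with copies of \<open>\<chi>\<close> on both sides; the laws
  for the two multiplications are exchanged.\<close>

lemma twisting_inverse:
  assumes "inverse_arrows C \<tau> \<chi>"
  shows "twisting C B A \<chi>"
proof
  let ?a = "carr A" and ?b = "carr B"
  have [simp]: "\<chi> \<in> arr C" "src C \<chi> = ?b \<odot> ?a" "trg C \<chi> = ?a \<odot> ?b"
    and inv: "\<chi> \<cdot> \<tau> = ide C (?a \<odot> ?b)" "\<tau> \<cdot> \<chi> = ide C (?b \<odot> ?a)"
    using assms by (auto simp: inverse_arrows_def hom_iff)
  show "\<chi> \<in> hom C (?b \<odot> ?a) (?a \<odot> ?b)" by (simp add: hom_iff)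
  note I = inv in_context[OF inv(2), of \<I> "?a", simplified]  in_context[OF inv(2), of "?a" \<I>, simplified]
   in_context[OF inv(2), of \<I> "?b", simplified]  in_context[OF inv(2), of "?b" \<I>, simplified]
  show "\<chi> \<cdot> (unt B \<otimes> ide C ?a) = ide C ?a \<otimes> unt B"
    using arg_cong[OF unt_right, of "\<lambda>z. \<chi> \<cdot> z"] by (simp add: I I[THEN chain_eq])
  show "\<chi> \<cdot> (ide C ?b \<otimes> unt A) = unt A \<otimes> ide C ?b"
    using arg_cong[OF unt_left, of "\<lambda>z. \<chi> \<cdot> z"] by (simp add: I I[THEN chain_eq])
  show "\<chi> \<cdot> (mul B \<otimes> ide C ?a) = (ide C ?a \<otimes> mul B) \<cdot> (\<chi> \<otimes> ide C ?b) \<cdot> (ide C ?b \<otimes> \<chi>)"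
    using arg_cong[OF mul_right, of "\<lambda>z. \<chi> \<cdot> z \<cdot> (\<chi> \<otimes> ide C ?b) \<cdot> (ide C ?b \<otimes> \<chi>)"]
    by (simp add: I I[THEN chain_eq])
  show "\<chi> \<cdot> (ide C ?b \<otimes> mul A) = (mul A \<otimes> ide C ?b) \<cdot> (ide C ?a \<otimes> \<chi>) \<cdot> (\<chi> \<otimes> ide C ?a)"
    using arg_cong[OF mul_left, of "\<lambda>z. \<chi> \<cdot> z \<cdot> (ide C ?a \<otimes> \<chi>) \<cdot> (\<chi> \<otimes> ide C ?a)"]
    by (simp add: I I[THEN chain_eq])
qed

end

section \<open>The Yang--Baxter equation\<close>

definition yang_baxter_eq ::
    "('o, 'm, 'x) moncat_scheme \<Rightarrow> 'o \<Rightarrow> 'o \<Rightarrow> 'o \<Rightarrow> 'm \<Rightarrow> 'm \<Rightarrow> 'm \<Rightarrow> bool" where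
  "yang_baxter_eq C X Y Z \<sigma>XY \<sigma>XZ \<sigma>YZ \<longleftrightarrow>
    (\<sigma>YZ \<otimes>\<^bsub>C\<^esub> ide C X) \<cdot>\<^bsub>C\<^esub> (ide C Y \<otimes>\<^bsub>C\<^esub> \<sigma>XZ) \<cdot>\<^bsub>C\<^esub> (\<sigma>XY \<otimes>\<^bsub>C\<^esub> ide C Z)
    = (ide C Z \<otimes>\<^bsub>C\<^esub> \<sigma>XY) \<cdot>\<^bsub>C\<^esub> (\<sigma>XZ \<otimes>\<^bsub>C\<^esub> ide C Y) \<cdot>\<^bsub>C\<^esub> (ide C X \<otimes>\<^bsub>C\<^esub> \<sigma>YZ)"

text \<open>On elements, both sides send \<open>a \<otimes> b \<otimes> c\<close> to \<open>1 \<otimes> 1 \<otimes> abc\<close>.\<close>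

lemma (in unital_algebra) yang_baxter_self:
  "yang_baxter_eq C (carr A) (carr A) (carr A) (unt A \<otimes> mul A) (unt A \<otimes> mul A) (unt A \<otimes> mul A)"
proof -
  let ?a = "carr A"
  note R = slide[of \<I> "unt A" \<I> "mul A" \<I>, simplified]
    slide[of \<I> "unt A" \<I> "unt A" ?a, simplified]
    in_context[OF mul_assoc, of \<I> \<I>, simplified]
    in_context[OF mul_unt, of \<I> ?a, simplified]
    in_context[OF unt_mul, of \<I> ?a, simplified]
    in_context[OF unt_mul, of ?a \<I>, simplified]
  show ?thesis
    by (simp add: yang_baxter_eq_def ten_split[of "unt A" "mul A"] R R[THEN chain_eq])
qed

context strict_monoidal_category begin

text \<open>A diagonal braiding \<open>\<nu> \<otimes> \<mu>\<close> multiplies two factors and inserts a unit. By naturality the inserted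
  unit passes through \<open>\<tau>\<close>, so both sides of the Yang--Baxter equation end with the same inserted unit
  in front of the two sides of the multiplication law. The unit can be removed again by multiplying.\<close>

lemma
  assumes "unital_algebra C A" "unital_algebra C B" "\<tau> \<in> hom C (carr A \<odot> carr B) (carr B \<odot> carr A)"
  shows yang_baxter_iff_mul_left: "\<tau> \<cdot> (unt A \<otimes> ide C (carr B)) = ide C (carr B) \<otimes> unt A \<Longrightarrow>
     yang_baxter_eq C (carr A) (carr A) (carr B) (unt A \<otimes> mul A) \<tau> \<tau> \<longleftrightarrow>
     \<tau> \<cdot> (mul A \<otimes> ide C (carr B)) = (ide C (carr B) \<otimes> mul A) \<cdot> (\<tau> \<otimes> ide C (carr A)) \<cdot> (ide C (carr A) \<otimes> \<tau>)"
       (is "?u \<Longrightarrow> ?yb \<longleftrightarrow> ?m")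
    and yang_baxter_iff_mul_right: "\<tau> \<cdot> (ide C (carr A) \<otimes> unt B) = unt B \<otimes> ide C (carr A) \<Longrightarrow>
     yang_baxter_eq C (carr A) (carr B) (carr B) \<tau> \<tau> (unt B \<otimes> mul B) \<longleftrightarrow>
     \<tau> \<cdot> (ide C (carr A) \<otimes> mul B) = (mul B \<otimes> ide C (carr A)) \<cdot> (ide C (carr B) \<otimes> \<tau>) \<cdot> (\<tau> \<otimes> ide C (carr B))"
       (is "?u' \<Longrightarrow> ?yb' \<longleftrightarrow> ?m'")
proof -
  interpret A: unital_algebra C A by fact
  interpret B: unital_algebra C B by fact
  let ?a = "carr A" and ?b = "carr B"
  have [simp]: "\<tau> \<in> arr C" "src C \<tau> = ?a \<odot> ?b" "trg C \<tau> = ?b \<odot> ?a"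
    using assms by (auto simp: hom_iff)
  note split = ten_split[of "unt A" "mul A"] ten_split[of "unt B" "mul B"]
  {
    assume u: ?u
    \<comment> \<open>the unit inserted by \<open>\<nu> \<otimes> \<mu>\<close> slides under the first \<open>\<tau>\<close> and is natural for the second\<close>
    note R = slide[of \<I> "unt A" \<I> \<tau> \<I>, simplified] in_context[OF u, of \<I> "?a", simplified]
      in_context[OF A.unt_mul, of "?b" "\<I>", simplified]
    show "?yb \<longleftrightarrow> ?m"
    proof
      assume ?yb
      from arg_cong[OF this[unfolded yang_baxter_eq_def], of "\<lambda>z. (ide C ?b \<otimes> mul A) \<cdot> z"]
      show ?m by (simp add: split R R[THEN chain_eq])
    next
      assume m: ?m
      show ?yb by (simp add: yang_baxter_eq_def split m R R[THEN chain_eq])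
    qed
  }
  {
    assume u: ?u'
    note R = slide[of \<I> "unt B" \<I> \<tau> \<I>, simplified] in_context[OF u, of \<I> "?b", simplified]
      in_context[OF B.unt_mul, of "\<I>" ?a, simplified]
    show "?yb' \<longleftrightarrow> ?m'"
    proof
      assume ?yb'
      from arg_cong[OF this[unfolded yang_baxter_eq_def], of "\<lambda>z. (mul B \<otimes> ide C ?a) \<cdot> z"]
      show ?m' by (simp add: split R R[THEN chain_eq])
    next
      assume m: ?m'
      show ?yb' by (simp add: yang_baxter_eq_def split m R R[THEN chain_eq])
    qed
  }
qed

text \<open>If the crossing of the last two, or of the first two, factors is invertible, then multiplying the Yang--Baxter
  equation with its inverse on both sides gives the equation for the exchanged factors.\<close>

lemma yang_baxter_inverse_YZ:
  assumes "X \<in> obj C" "Y \<in> obj C" "Z \<in> obj C"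
    and "\<alpha> \<in> hom C (X \<odot> Y) (Y \<odot> X)" "\<beta> \<in> hom C (X \<odot> Z) (Z \<odot> X)" "\<xi> \<in> hom C (Y \<odot> Z) (Z \<odot> Y)"
    and yb: "yang_baxter_eq C X Y Z \<alpha> \<beta> \<xi>" and "inverse_arrows C \<xi> \<chi>"
  shows "yang_baxter_eq C X Z Y \<beta> \<alpha> \<chi>"
proof -
  have [simp]: "X \<in> obj C" "Y \<in> obj C" "Z \<in> obj C"
    "\<alpha> \<in> arr C" "src C \<alpha> = X \<odot> Y" "trg C \<alpha> = Y \<odot> X"
    "\<beta> \<in> arr C" "src C \<beta> = X \<odot> Z" "trg C \<beta> = Z \<odot> X"
    "\<xi> \<in> arr C" "src C \<xi> = Y \<odot> Z" "trg C \<xi> = Z \<odot> Y"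
    "\<chi> \<in> arr C" "src C \<chi> = Z \<odot> Y" "trg C \<chi> = Y \<odot> Z"
    and inv: "\<chi> \<cdot> \<xi> = ide C (Y \<odot> Z)" "\<xi> \<cdot> \<chi> = ide C (Z \<odot> Y)"
    using assms by (auto simp: hom_iff inverse_arrows_def)
  note I = in_context[OF inv(1), of \<I> X, simplified] in_context[OF inv(2), of X \<I>, simplified]
  show ?thesis
    using arg_cong[OF yb[unfolded yang_baxter_eq_def], of "\<lambda>z. (\<chi> \<otimes> ide C X) \<cdot> z \<cdot> (ide C X \<otimes> \<chi>)"]
    by (simp add: yang_baxter_eq_def I I[THEN chain_eq])
qed

lemma yang_baxter_inverse_XY:
  assumes "X \<in> obj C" "Y \<in> obj C" "Z \<in> obj C"
    and "\<xi> \<in> hom C (X \<odot> Y) (Y \<odot> X)" "\<alpha> \<in> hom C (X \<odot> Z) (Z \<odot> X)" "\<beta> \<in> hom C (Y \<odot> Z) (Z \<odot> Y)"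
    and yb: "yang_baxter_eq C X Y Z \<xi> \<alpha> \<beta>" and "inverse_arrows C \<xi> \<chi>"
  shows "yang_baxter_eq C Y X Z \<chi> \<beta> \<alpha>"
proof -
  have [simp]: "X \<in> obj C" "Y \<in> obj C" "Z \<in> obj C"
    "\<xi> \<in> arr C" "src C \<xi> = X \<odot> Y" "trg C \<xi> = Y \<odot> X"
    "\<alpha> \<in> arr C" "src C \<alpha> = X \<odot> Z" "trg C \<alpha> = Z \<odot> X"
    "\<beta> \<in> arr C" "src C \<beta> = Y \<odot> Z" "trg C \<beta> = Z \<odot> Y"
    "\<chi> \<in> arr C" "src C \<chi> = Y \<odot> X" "trg C \<chi> = X \<odot> Y"
    and inv: "\<chi> \<cdot> \<xi> = ide C (X \<odot> Y)" "\<xi> \<cdot> \<chi> = ide C (Y \<odot> X)"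
    using assms by (auto simp: hom_iff inverse_arrows_def)
  note I = in_context[OF inv(1), of Z \<I>, simplified] in_context[OF inv(2), of \<I> Z, simplified]
  show ?thesis
    using arg_cong[OF yb[unfolded yang_baxter_eq_def], of "\<lambda>z. (ide C Z \<otimes> \<chi>) \<cdot> z \<cdot> (\<chi> \<otimes> ide C Z)"]
    by (simp add: yang_baxter_eq_def I I[THEN chain_eq])
qed

end

section \<open>Composing twistings\<close>

text \<open>Moving \<open>A \<otimes> X\<close> past \<open>D\<close> one factor at a time respects the multiplication of \<open>A \<otimes> X\<close>, which itself involves
  the crossing \<open>\<tau>\<close>: compatibility means that \<open>\<tau>\<close> may be done before or after the passage of \<open>D\<close>, and
  this is the Yang--Baxter equation.\<close>

lemma twisting_twisted_product:
  fixes C :: "('o, 'm, 'x) moncat_scheme" (structure)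
  assumes "twisting C X A \<tau>" "twisting C X D \<rho>" "twisting C A D \<sigma>"
    and yb: "yang_baxter_eq C (carr X) (carr A) (carr D) \<tau> \<rho> \<sigma>"
  shows "twisting C (twisted_product C X A \<tau>) D ((\<sigma> \<otimes> ide C (carr X)) \<cdot> (ide C (carr A) \<otimes> \<rho>))"
proof -
  interpret strict_monoidal_category C using assms(1) by (simp add: twisting_def unital_algebra_def)
  interpret T: twisting C X A \<tau> by fact
  interpret R: twisting C X D \<rho> by fact
  interpret S: twisting C A D \<sigma> by fact
  interpret P: unital_algebra C "twisted_product C X A \<tau>" by (rule T.twisted_product_algebra)
  let ?x = "carr X" and ?a = "carr A" and ?d = "carr D"
  note split = ten_split[of "mul A" "mul X"] ten_split[of "unt A" "unt X"]
  show ?thesis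
  proof
    show "(\<sigma> \<otimes> ide C ?x) \<cdot> (ide C ?a \<otimes> \<rho>)
        \<in> hom C (carr (twisted_product C X A \<tau>) \<odot> ?d) (?d \<odot> carr (twisted_product C X A \<tau>))"
      by (simp add: hom_iff)
    show "((\<sigma> \<otimes> ide C ?x) \<cdot> (ide C ?a \<otimes> \<rho>)) \<cdot> (unt (twisted_product C X A \<tau>) \<otimes> ide C ?d)
       = ide C ?d \<otimes> unt (twisted_product C X A \<tau>)"
    proof -
      note R = slide[of \<I> "unt A" \<I> \<rho> \<I>, simplified]
        in_context[OF R.unt_left, of \<I> \<I>, simplified]
        in_context[OF S.unt_left, of \<I> ?x, simplified]
      show ?thesis by (simp add: split R R[THEN chain_eq])
    qed
    show "((\<sigma> \<otimes> ide C ?x) \<cdot> (ide C ?a \<otimes> \<rho>)) \<cdot> (ide C (carr (twisted_product C X A \<tau>)) \<otimes> unt D)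
       = unt D \<otimes> ide C (carr (twisted_product C X A \<tau>))"
    proof -
      note R = in_context[OF R.unt_right, of ?a \<I>, simplified]
        in_context[OF S.unt_right, of \<I> ?x, simplified]
      show ?thesis by (simp add: split R R[THEN chain_eq])
    qed
    show "((\<sigma> \<otimes> ide C ?x) \<cdot> (ide C ?a \<otimes> \<rho>)) \<cdot> (mul (twisted_product C X A \<tau>) \<otimes> ide C ?d) =
      (ide C ?d \<otimes> mul (twisted_product C X A \<tau>)) \<cdot>
      (((\<sigma> \<otimes> ide C ?x) \<cdot> (ide C ?a \<otimes> \<rho>)) \<otimes> ide C (carr (twisted_product C X A \<tau>))) \<cdot>
      (ide C (carr (twisted_product C X A \<tau>)) \<otimes> ((\<sigma> \<otimes> ide C ?x) \<cdot> (ide C ?a \<otimes> \<rho>)))"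
    proof -
      note R = slide[of \<I> "mul A" \<I> \<rho> \<I>, simplified]
        slide[of ?a \<tau> ?x \<rho> \<I>, simplified]
        slide[of ?a \<tau> \<I> \<rho> \<I>, simplified]
        slide[of \<I> \<sigma> \<I> \<tau> ?x, simplified]
        slide[of \<I> \<sigma> ?a "mul X" \<I>, simplified]
        slide[of ?a \<sigma> \<I> "mul X" \<I>, simplified]
        in_context[OF R.mul_left, of "?a \<odot> ?a" \<I>, simplified]
        in_context[OF S.mul_left, of \<I> ?x, simplified]
      note Y = in_context[OF yb[unfolded yang_baxter_eq_def, symmetric], of ?a ?x, simplified]
      show ?thesis by (simp add: split R R[THEN chain_eq] Y Y[THEN chain3_eq])
    qed
    show "((\<sigma> \<otimes> ide C ?x) \<cdot> (ide C ?a \<otimes> \<rho>)) \<cdot> (ide C (carr (twisted_product C X A \<tau>)) \<otimes> mul D) =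
      (mul D \<otimes> ide C (carr (twisted_product C X A \<tau>))) \<cdot>
      (ide C ?d \<otimes> ((\<sigma> \<otimes> ide C ?x) \<cdot> (ide C ?a \<otimes> \<rho>))) \<cdot>
      (((\<sigma> \<otimes> ide C ?x) \<cdot> (ide C ?a \<otimes> \<rho>)) \<otimes> ide C ?d)"
    proof -
      note R = slide[of \<I> \<sigma> \<I> \<rho> \<I>, simplified]
        in_context[OF R.mul_right, of ?a \<I>, simplified]
        in_context[OF S.mul_right, of \<I> ?x, simplified]
      show ?thesis by (simp add: split R R[THEN chain_eq])
    qed
  qed
qed

text \<open>Pulling \<open>Y \<otimes> X\<close> through the crossing \<open>\<delta>\<close> amounts to pulling through \<open>Y\<close> and then \<open>X\<close>.\<close>

lemma (in strict_monoidal_category) yang_baxter_ten: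
  assumes "X \<in> obj C" "Y \<in> obj C" "D \<in> obj C" "E \<in> obj C"
    and "\<rho>D \<in> hom C (X \<odot> D) (D \<odot> X)" "\<rho>E \<in> hom C (X \<odot> E) (E \<odot> X)"
    and "\<sigma>D \<in> hom C (Y \<odot> D) (D \<odot> Y)" "\<sigma>E \<in> hom C (Y \<odot> E) (E \<odot> Y)"
    and "\<delta> \<in> hom C (D \<odot> E) (E \<odot> D)"
    and ybX: "yang_baxter_eq C X D E \<rho>D \<rho>E \<delta>" and ybY: "yang_baxter_eq C Y D E \<sigma>D \<sigma>E \<delta>"
  shows "yang_baxter_eq C (Y \<odot> X) D E ((\<sigma>D \<otimes> ide C X) \<cdot> (ide C Y \<otimes> \<rho>D)) ((\<sigma>E \<otimes> ide C X) \<cdot> (ide C Y \<otimes> \<rho>E)) \<delta>"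
proof -
  have [simp]: "X \<in> obj C" "Y \<in> obj C" "D \<in> obj C" "E \<in> obj C"
    "\<rho>D \<in> arr C" "src C \<rho>D = X \<odot> D" "trg C \<rho>D = D \<odot> X"
    "\<rho>E \<in> arr C" "src C \<rho>E = X \<odot> E" "trg C \<rho>E = E \<odot> X"
    "\<sigma>D \<in> arr C" "src C \<sigma>D = Y \<odot> D" "trg C \<sigma>D = D \<odot> Y"
    "\<sigma>E \<in> arr C" "src C \<sigma>E = Y \<odot> E" "trg C \<sigma>E = E \<odot> Y"
    "\<delta> \<in> arr C" "src C \<delta> = D \<odot> E" "trg C \<delta> = E \<odot> D"
    using assms by (auto simp: hom_iff)
  note R = slide[of \<I> \<sigma>D \<I> \<rho>E \<I>, simplified] slide[of \<I> \<sigma>E \<I> \<rho>D \<I>, simplified]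
  note Y = in_context[OF ybX[unfolded yang_baxter_eq_def], of Y \<I>, simplified]
    in_context[OF ybY[unfolded yang_baxter_eq_def], of \<I> X, simplified]
  show ?thesis
    by (simp add: yang_baxter_eq_def R R[THEN chain_eq] Y Y[THEN chain3_eq])
qed

text \<open>The homomorphisms pass through the two multiplications, and by naturality through the crossing between
  them. The products are assumed to be algebras, instead of \<open>\<tau>\<close> and \<open>\<tau>'\<close> to be twistings, because for the regrouped products
  in \<open>swap_hom_base\<close> the former is already known from the original grouping.\<close>

lemma twisted_product_hom:
  fixes C :: "('o, 'm, 'x) moncat_scheme" (structure)
  assumes "algebra_hom C A A' f" "algebra_hom C B B' g"
    and "\<tau> \<in> hom C (carr A \<odot> carr B) (carr B \<odot> carr A)"
    and "\<tau>' \<in> hom C (carr A' \<odot> carr B') (carr B' \<odot> carr A')"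
    and "unital_algebra C (twisted_product C A B \<tau>)" "unital_algebra C (twisted_product C A' B' \<tau>')"
    and nat: "\<tau>' \<cdot> (f \<otimes> g) = (g \<otimes> f) \<cdot> \<tau>"
  shows "algebra_hom C (twisted_product C A B \<tau>) (twisted_product C A' B' \<tau>') (g \<otimes> f)"
proof -
  interpret strict_monoidal_category C using assms(5) by (simp add: unital_algebra_def)
  interpret F: algebra_hom C A A' f by fact
  interpret G: algebra_hom C B B' g by fact
  interpret P: unital_algebra C "twisted_product C A B \<tau>" by fact
  interpret P': unital_algebra C "twisted_product C A' B' \<tau>'" by fact
  have [simp]: "\<tau> \<in> arr C" "src C \<tau> = carr A \<odot> carr B" "trg C \<tau> = carr B \<odot> carr A"
    "\<tau>' \<in> arr C" "src C \<tau>' = carr A' \<odot> carr B'" "trg C \<tau>' = carr B' \<odot> carr A'"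
    using assms by (auto simp: hom_iff)
  have [simp]: "f \<in> arr C" "src C f = carr A" "trg C f = carr A'"
    "g \<in> arr C" "src C g = carr B" "trg C g = carr B'"
    using F.hom G.hom by (auto simp: hom_iff)
  let ?a = "carr A" and ?b = "carr B" and ?a' = "carr A'" and ?b' = "carr B'"
  note split = ten_split[of "mul B" "mul A"] ten_split[of "unt B" "unt A"]
    ten_split[of "mul B'" "mul A'"] ten_split[of "unt B'" "unt A'"]
    ten_split[of g f] ten_split[of f g] ten_split[of f f] ten_split[of g g]
  show ?thesis
  proof
    show "g \<otimes> f \<in> hom C (carr (twisted_product C A B \<tau>)) (carr (twisted_product C A' B' \<tau>'))"
      by (simp add: hom_iff)
    show "(g \<otimes> f) \<cdot> mul (twisted_product C A B \<tau>)
        = mul (twisted_product C A' B' \<tau>') \<cdot> ((g \<otimes> f) \<otimes> (g \<otimes> f))"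
    proof -
      \<comment> \<open>the multiplicativity of \<open>f\<close> and \<open>g\<close> and the naturality of the twistings, split into layers\<close>
      have layered: "f \<cdot> mul A = mul A' \<cdot> (f \<otimes> ide C ?a') \<cdot> (ide C ?a \<otimes> f)"
        "g \<cdot> mul B = mul B' \<cdot> (g \<otimes> ide C ?b') \<cdot> (ide C ?b \<otimes> g)"
        "\<tau>' \<cdot> (f \<otimes> ide C ?b') \<cdot> (ide C ?a \<otimes> g) = (g \<otimes> ide C ?a') \<cdot> (ide C ?b \<otimes> f) \<cdot> \<tau>"
        using F.hom_mul G.hom_mul nat by (simp_all add: split)
      note R = in_context[OF layered(2), of \<I> ?a', simplified]
        in_context[OF layered(1), of "?b \<odot> ?b" \<I>, simplified]
        slide[of \<I> "mul B" \<I> f \<I>, simplified]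
        slide[of ?b \<tau> \<I> f \<I>, simplified]
        slide[of ?b g \<I> "mul A'" \<I>, simplified]
        slide[of \<I> g ?b' "mul A'" \<I>, simplified]
        slide[of \<I> g \<I> \<tau>' ?a', simplified]
      note Y = in_context[OF layered(3), of ?b ?a', simplified]
      have gfgf: "(g \<otimes> f) \<otimes> (g \<otimes> f) = (g \<otimes> ide C (?a' \<odot> ?b' \<odot> ?a')) \<cdot> (ide C ?b \<otimes> f \<otimes> ide C (?b' \<odot> ?a'))
          \<cdot> (ide C (?b \<odot> ?a) \<otimes> g \<otimes> ide C ?a') \<cdot> (ide C (?b \<odot> ?a \<odot> ?b) \<otimes> f)"
        using ten_split[of "g \<otimes> f" "g \<otimes> f"] by (simp add: split)
      show ?thesis
        unfolding twisted_product_simps gfgf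
        by (simp add: split R R[THEN chain_eq] Y Y[THEN chain3_eq])
    qed
    show "(g \<otimes> f) \<cdot> unt (twisted_product C A B \<tau>) = unt (twisted_product C A' B' \<tau>')"
    proof -
      note R = slide[of \<I> "unt B" \<I> f \<I>, simplified]
        in_context[OF G.hom_unt, of \<I> ?a', simplified]
      show ?thesis by (simp add: split R R[THEN chain_eq] F.hom_unt G.hom_unt)
    qed
  qed
qed

context twisting begin

text \<open>\<open>\<chi>\<close> moves past the multiplications of \<open>B\<close> and of \<open>A\<close> by the laws of a twisting. This turns \<open>\<chi>\<close> into four
  copies of itself, one of which cancels the \<open>\<tau>\<close> in the multiplication of the source.\<close>

lemma inverse_hom:
  assumes "inverse_arrows C \<tau> \<chi>"
  shows "algebra_hom C (twisted_product C A B \<tau>) (twisted_product C B A \<chi>) \<chi>"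
proof -
  interpret T: twisting C B A \<chi> using assms by (rule twisting_inverse)
  interpret P: unital_algebra C "twisted_product C A B \<tau>" by (rule twisted_product_algebra)
  interpret P': unital_algebra C "twisted_product C B A \<chi>" by (rule T.twisted_product_algebra)
  let ?a = "carr A" and ?b = "carr B"
  have inv: "\<chi> \<cdot> \<tau> = ide C (?a \<odot> ?b)"
    using assms by (auto simp: inverse_arrows_def hom_iff)
  note split = ten_split[of "mul B" "mul A"] ten_split[of "unt B" "unt A"]
     ten_split[of "mul A" "mul B"] ten_split[of "unt A" "unt B"] ten_split[of \<chi> \<chi>]
  show ?thesis
  proof
    show "\<chi> \<in> hom C (carr (twisted_product C A B \<tau>)) (carr (twisted_product C B A \<chi>))"
      by (simp add: hom_iff)
    show "\<chi> \<cdot> mul (twisted_product C A B \<tau>) = mul (twisted_product C B A \<chi>) \<cdot> (\<chi> \<otimes> \<chi>)"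
    proof -
      note R = in_context[OF T.mul_left, of \<I> \<I>, simplified]
        in_context[OF T.mul_right, of "?b" \<I>, simplified]
        in_context[OF T.mul_right, of \<I> ?b, simplified]
        in_context[OF inv, of "?b" ?a, simplified]
        slide[of \<I> "mul A" \<I> "mul B" \<I>, simplified]
      show ?thesis by (simp add: split R R[THEN chain_eq])
    qed
    show "\<chi> \<cdot> unt (twisted_product C A B \<tau>) = unt (twisted_product C B A \<chi>)"
      using slide[of \<I> "unt A" \<I> "unt B" \<I>, simplified]
        in_context[OF T.unt_left, of \<I> \<I>, simplified] chain_eq[OF T.unt_left, of "unt A"]
        by (simp add: split)
  qed
qed

end

text \<open>Both sides are \<open>B \<otimes> A \<otimes> X\<close> with the multiplication that performs \<open>\<beta>\<close>, \<open>\<xi>\<close>, \<open>\<alpha>\<close> and then multiplies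
  factorwise. The crossings \<open>\<xi>\<close> and \<open>\<alpha>\<close> act on disjoint factors at that moment, so their order is immaterial.\<close>

lemma twisted_product_assoc:
  fixes C :: "('o, 'm, 'x) moncat_scheme" (structure)
  assumes "twisting C X A \<alpha>" "twisting C X B \<beta>" "twisting C A B \<xi>"
  shows "twisted_product C (twisted_product C X A \<alpha>) B ((\<xi> \<otimes> ide C (carr X)) \<cdot> (ide C (carr A) \<otimes> \<beta>))
    = twisted_product C X (twisted_product C A B \<xi>) ((ide C (carr B) \<otimes> \<alpha>) \<cdot> (\<beta> \<otimes> ide C (carr A)))"
proof -
  interpret strict_monoidal_category C using assms(1) by (simp add: twisting_def unital_algebra_def)
  interpret T: twisting C X A \<alpha> by fact
  interpret R: twisting C X B \<beta> by fact
  interpret S: twisting C A B \<xi> by fact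
  let ?x = "carr X" and ?a = "carr A" and ?b = "carr B"
  note split = ten_split[of "mul A" "mul X"] ten_split[of "mul B" "mul A"]
     ten_split[of "mul B" "mul A \<otimes> ide C ?x"]
     ten_split[of "mul B" "ide C Z \<otimes> mul X" for Z]
  note R = slide[of ?b \<xi> \<I> \<alpha> ?x, simplified]
    slide[of ?b \<xi> ?a "mul X" \<I>, simplified]
    slide[of ?b \<xi> \<I> "mul X" \<I>, simplified]
    slide[of "?b \<odot> ?b" "mul A" \<I> "mul X" \<I>, simplified]
  show ?thesis
    by (simp add: twisted_product_def split R R[THEN chain_eq]
       ten_comp_left ten_comp_right)
qed

section \<open>Braided systems of algebras\<close>

text \<open>The equations on triples with a repetition are traded for the multiplication laws of the twistings.\<close>

lemma (in strict_monoidal_category) braided_system_of_algebras_iff: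
  "braided_system_of_algebras C r A \<xi> \<longleftrightarrow>
    (\<forall>k. 1 \<le> k \<and> k \<le> r \<longrightarrow> unital_algebra C (A k)) \<and>
    (\<forall>k l. 1 \<le> k \<and> k < l \<and> l \<le> r \<longrightarrow> twisting C (A k) (A l) (\<xi> k l)) \<and>
    (\<forall>k l m. 1 \<le> k \<and> k < l \<and> l < m \<and> m \<le> r \<longrightarrow>
       yang_baxter_eq C (carr (A k)) (carr (A l)) (carr (A m)) (\<xi> k l) (\<xi> k m) (\<xi> l m))"
  (is "?L \<longleftrightarrow> ?A \<and> ?T \<and> ?Y")
proof
  assume ?L
  then interpret S: braided_system_of_algebras C r A \<xi> .
  interpret B: braided_system C r "\<lambda>k. carr (A k)" "with_diagonal C A \<xi>" by (rule S.braided)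
  have yb: "yang_baxter_eq C (carr (A k)) (carr (A l)) (carr (A m))
      (with_diagonal C A \<xi> k l) (with_diagonal C A \<xi> k m) (with_diagonal C A \<xi> l m)"
    if "1 \<le> k" "k \<le> l" "l \<le> m" "m \<le> r" for k l m
    using B.yang_baxter[OF that] by (simp add: yang_baxter_eq_def)
  have ?A using S.algebras by blast
  moreover have ?Y
  proof (intro allI impI)
    fix k l m assume "1 \<le> k \<and> k < l \<and> l < m \<and> m \<le> r"
    then show "yang_baxter_eq C (carr (A k)) (carr (A l)) (carr (A m)) (\<xi> k l) (\<xi> k m) (\<xi> l m)"
      using yb[of k l m] by (simp add: with_diagonal_def)
  qed
  moreover have ?T
  proof (intro allI impI)
    fix k l assume kl: "1 \<le> k \<and> k < l \<and> l \<le> r"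
    interpret K: unital_algebra C "A k" using kl S.algebras by simp
    interpret L: unital_algebra C "A l" using kl S.algebras by simp
    have h: "\<xi> k l \<in> hom C (carr (A k) \<odot> carr (A l)) (carr (A l) \<odot> carr (A k))"
      using kl by (intro S.\<xi>_hom) auto
    have u: "\<xi> k l \<cdot> (unt (A k) \<otimes> ide C (carr (A l))) = ide C (carr (A l)) \<otimes> unt (A k)"
      "\<xi> k l \<cdot> (ide C (carr (A k)) \<otimes> unt (A l)) = unt (A l) \<otimes> ide C (carr (A k))"
      using kl S.natural_unt_left S.natural_unt_right by auto
    show "twisting C (A k) (A l) (\<xi> k l)"
    proof
      show "\<xi> k l \<cdot> (mul (A k) \<otimes> ide C (carr (A l))) =
          (ide C (carr (A l)) \<otimes> mul (A k)) \<cdot> (\<xi> k l \<otimes> ide C (carr (A k))) \<cdot> (ide C (carr (A k)) \<otimes> \<xi> k l)"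
        using yb[of k k l] kl yang_baxter_iff_mul_left[OF K.unital_algebra_axioms L.unital_algebra_axioms h u(1)]
        by (simp add: with_diagonal_def)
      show "\<xi> k l \<cdot> (ide C (carr (A k)) \<otimes> mul (A l)) =
          (mul (A l) \<otimes> ide C (carr (A k))) \<cdot> (ide C (carr (A l)) \<otimes> \<xi> k l) \<cdot> (\<xi> k l \<otimes> ide C (carr (A l)))"
        using yb[of k l l] kl yang_baxter_iff_mul_right[OF K.unital_algebra_axioms L.unital_algebra_axioms h u(2)]
        by (simp add: with_diagonal_def)
    qed (use h u in auto)
  qed
  ultimately show "?A \<and> ?T \<and> ?Y" by blast
next
  assume R: "?A \<and> ?T \<and> ?Y"
  have alg: "unital_algebra C (A k)" if "1 \<le> k" "k \<le> r" for k using R that by blast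
  have tw: "twisting C (A k) (A l) (\<xi> k l)" if "1 \<le> k" "k < l" "l \<le> r" for k l using R that by blast
  show ?L
  proof (rule braided_system_of_algebras.intro[OF strict_monoidal_category_axioms braided_system_of_algebras_axioms.intro])
    fix k assume "1 \<le> k" "k \<le> r"
    then show "unital_algebra C (A k)" by (rule alg)
  next
    fix k l assume kl: "1 \<le> k" "k < l" "l \<le> r"
    then interpret T: twisting C "A k" "A l" "\<xi> k l" by (rule tw)
    show "\<xi> k l \<in> hom C (carr (A k) \<odot> carr (A l)) (carr (A l) \<odot> carr (A k))"
      and "\<xi> k l \<cdot> (unt (A k) \<otimes> ide C (carr (A l))) = ide C (carr (A l)) \<otimes> unt (A k)"
      and "\<xi> k l \<cdot> (ide C (carr (A k)) \<otimes> unt (A l)) = unt (A l) \<otimes> ide C (carr (A k))"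
      by (rule T.twist_hom T.unt_left T.unt_right)+
  next
    show "braided_system C r (\<lambda>k. carr (A k)) (with_diagonal C A \<xi>)"
    proof
      fix k assume "1 \<le> k" "k \<le> r"
      then interpret unital_algebra C "A k" by (rule alg)
      show "carr (A k) \<in> obj C" by simp
    next
      fix k l assume kl: "1 \<le> k" "k \<le> l" "l \<le> r"
      show "with_diagonal C A \<xi> k l \<in> hom C (carr (A k) \<odot> carr (A l)) (carr (A l) \<odot> carr (A k))"
      proof (cases "k = l")
        case True
        interpret unital_algebra C "A l" using kl by (auto intro: alg)
        show ?thesis using True by (simp add: with_diagonal_def hom_iff)
      next
        case False
        then show ?thesis using tw[of k l] kl twisting.twist_hom by (fastforce simp: with_diagonal_def)
      qed
    next
      fix k l m assume klm: "1 \<le> k" "k \<le> l" "l \<le> m" "m \<le> r"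
      let ?\<sigma> = "with_diagonal C A \<xi>"
      interpret K: unital_algebra C "A k" using klm by (auto intro: alg)
      have "yang_baxter_eq C (carr (A k)) (carr (A l)) (carr (A m)) (?\<sigma> k l) (?\<sigma> k m) (?\<sigma> l m)"
      proof (cases "k = l"; cases "l = m")
        assume "k = l" "l = m"
        then show ?thesis using K.yang_baxter_self by (simp add: with_diagonal_def)
      next
        assume "k = l" "l \<noteq> m"
        interpret T: twisting C "A k" "A m" "\<xi> k m" using \<open>k = l\<close> \<open>l \<noteq> m\<close> klm by (intro tw) auto
        show ?thesis using \<open>k = l\<close> \<open>l \<noteq> m\<close>
          yang_baxter_iff_mul_left[OF K.unital_algebra_axioms T.B.unital_algebra_axioms T.twist_hom T.unt_left] T.mul_left
          by (simp add: with_diagonal_def)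
      next
        assume "k \<noteq> l" "l = m"
        interpret T: twisting C "A k" "A m" "\<xi> k m" using \<open>l = m\<close> \<open>k \<noteq> l\<close> klm by (intro tw) auto
        show ?thesis using \<open>l = m\<close> \<open>k \<noteq> l\<close>
          yang_baxter_iff_mul_right[OF K.unital_algebra_axioms T.B.unital_algebra_axioms T.twist_hom T.unt_right] T.mul_right
          by (simp add: with_diagonal_def)
      next
        assume "k \<noteq> l" "l \<noteq> m"
        then have "k < l" "l < m" using klm by auto
        then show ?thesis using R klm by (simp add: with_diagonal_def)
      qed
      then show "(?\<sigma> l m \<otimes> ide C (carr (A k))) \<cdot> (ide C (carr (A l)) \<otimes> ?\<sigma> k m) \<cdot> (?\<sigma> k l \<otimes> ide C (carr (A m)))
        = (ide C (carr (A m)) \<otimes> ?\<sigma> k l) \<cdot> (?\<sigma> k m \<otimes> ide C (carr (A l))) \<cdot> (ide C (carr (A k)) \<otimes> ?\<sigma> l m)"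
        by (simp add: yang_baxter_eq_def)
    qed
  qed
qed

text \<open>Exchanging two neighbours reverses no other pair, so for all other pairs and for all triples not containing
  both, the data of the permuted system are data of the original one.\<close>

lemma transpose_Suc_less:
  fixes i k l :: nat
  assumes "k < l" "\<not> (k = i \<and> l = Suc i)"
  shows "transpose i (Suc i) k < transpose i (Suc i) l"
  using assms by (auto simp: transpose_def)

lemma transpose_Suc_bounds:
  fixes i k r :: nat
  assumes "1 \<le> i" "i < r" "1 \<le> k" "k \<le> r"
  shows "1 \<le> transpose i (Suc i) k" "transpose i (Suc i) k \<le> r"
  using assms by (auto simp: transpose_def)

context braided_system_of_algebras begin

lemma twisting_pair: "1 \<le> k \<Longrightarrow> k < l \<Longrightarrow> l \<le> r \<Longrightarrow> twisting C (A k) (A l) (\<xi> k l)"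
  using braided_system_of_algebras_axioms by (simp add: braided_system_of_algebras_iff)

lemma yang_baxter_triple: "1 \<le> k \<Longrightarrow> k < l \<Longrightarrow> l < m \<Longrightarrow> m \<le> r \<Longrightarrow>
    yang_baxter_eq C (carr (A k)) (carr (A l)) (carr (A m)) (\<xi> k l) (\<xi> k m) (\<xi> l m)"
  using braided_system_of_algebras_axioms by (simp add: braided_system_of_algebras_iff)

lemma swap_braided_system:
  assumes i: "1 \<le> i" "i < r" and inv: "invertible C (\<xi> i (Suc i))"
  shows "braided_system_of_algebras C r (swap_family i A) (swap_braiding C i \<xi>)"
  unfolding braided_system_of_algebras_iff
proof (intro conjI allI impI)
  let ?t = "transpose i (Suc i)"
  note [simp] = swap_family_def
  have off: "swap_braiding C i \<xi> k l = \<xi> (?t k) (?t l)" if "\<not> (k = i \<and> l = Suc i)" for k l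
    using that by (auto simp: swap_braiding_def)
  have on: "swap_braiding C i \<xi> i (Suc i) = inv_arr C (\<xi> i (Suc i))"
    by (simp add: swap_braiding_def)
  have inverse: "inverse_arrows C (\<xi> i (Suc i)) (inv_arr C (\<xi> i (Suc i)))"
    by (rule inverse_arrows_inv_arr[OF inv])
  have obj: "carr (A k) \<in> obj C" if "1 \<le> k" "k \<le> r" for k
    using algebras[OF that] by (rule unital_algebra.carr_obj)
  show "unital_algebra C (swap_family i A k)" if "1 \<le> k \<and> k \<le> r" for k
    using that algebras transpose_Suc_bounds[OF i] by simp
  fix k l
  show "twisting C (swap_family i A k) (swap_family i A l) (swap_braiding C i \<xi> k l)" if "1 \<le> k \<and> k < l \<and> l \<le> r"
  proof (cases "k = i \<and> l = Suc i")
    case True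
    interpret twisting C "A i" "A (Suc i)" "\<xi> i (Suc i)" using i by (intro twisting_pair) auto
    show ?thesis using True on twisting_inverse[OF inverse] by simp
  next
    case False
    then show ?thesis using that transpose_Suc_bounds[OF i] transpose_Suc_less[of k l i] off
      by (auto intro!: twisting_pair)
  qed
  fix m
  assume klm: "1 \<le> k \<and> k < l \<and> l < m \<and> m \<le> r"
  show "yang_baxter_eq C (carr (swap_family i A k)) (carr (swap_family i A l)) (carr (swap_family i A m))
     (swap_braiding C i \<xi> k l) (swap_braiding C i \<xi> k m) (swap_braiding C i \<xi> l m)"
  proof -
    \<comment> \<open>as neighbours, \<open>i\<close> and \<open>i + 1\<close> can only be the first two or the last two letters of the triple\<close>
    consider "k = i \<and> l = Suc i" | "l = i \<and> m = Suc i" | "\<not> (k = i \<and> l = Suc i)" "\<not> (l = i \<and> m = Suc i)" by blast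
    then show ?thesis
    proof cases
      case 1
      have "yang_baxter_eq C (carr (A (Suc i))) (carr (A i)) (carr (A m)) (inv_arr C (\<xi> i (Suc i))) (\<xi> (Suc i) m) (\<xi> i m)"
        by (rule yang_baxter_inverse_XY[OF _ _ _ _ _ _ yang_baxter_triple inverse]) (use 1 klm in \<open>auto intro!: obj \<xi>_hom\<close>)
      with 1 klm show ?thesis by (simp add: on off)
    next
      case 2
      have "yang_baxter_eq C (carr (A k)) (carr (A (Suc i))) (carr (A i)) (\<xi> k (Suc i)) (\<xi> k i) (inv_arr C (\<xi> i (Suc i)))"
        by (rule yang_baxter_inverse_YZ[OF _ _ _ _ _ _ yang_baxter_triple inverse]) (use 2 klm in \<open>auto intro!: obj \<xi>_hom\<close>)
      with 2 klm show ?thesis by (simp add: on off)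
    next
      case 3
      then have "\<not> (k = i \<and> m = Suc i)" using klm by auto
      with 3 klm show ?thesis
        using transpose_Suc_bounds[OF i] transpose_Suc_less[of k l i] transpose_Suc_less[of l m i]
        by (auto simp: off intro!: yang_baxter_triple)
    qed
  qed
qed

end

section \<open>Iterated twisted products\<close>

definition unit_algebra :: "('o, 'm, 'x) moncat_scheme \<Rightarrow> ('o, 'm) alg" where
  "unit_algebra C = \<lparr>carr = \<I>\<^bsub>C\<^esub>, mul = ide C \<I>\<^bsub>C\<^esub>, unt = ide C \<I>\<^bsub>C\<^esub>\<rparr>"

lemma unit_algebra_simps [simp]:
  "carr (unit_algebra C) = \<I>\<^bsub>C\<^esub>" "mul (unit_algebra C) = ide C \<I>\<^bsub>C\<^esub>" "unt (unit_algebra C) = ide C \<I>\<^bsub>C\<^esub>"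
  by (simp_all add: unit_algebra_def)

lemma (in strict_monoidal_category) unit_algebra: "unital_algebra C (unit_algebra C)"
  by unfold_locales (simp_all add: hom_iff)

lemma (in unital_algebra) twisting_unit_algebra: "twisting C (unit_algebra C) A (ide C (carr A))"
  by (intro twisting.intro unit_algebra unital_algebra_axioms strict_monoidal_category_axioms, unfold_locales) (simp_all add: hom_iff)

lemma ten_obj_list_simps [simp]:
  "ten_obj_list C [] = \<I>\<^bsub>C\<^esub>" "ten_obj_list C (X # Xs) = X \<odot>\<^bsub>C\<^esub> ten_obj_list C Xs"
  by (simp_all add: ten_obj_list_def)

lemma ten_arr_list_simps [simp]:
  "ten_arr_list C [] = ide C \<I>\<^bsub>C\<^esub>" "ten_arr_list C (f # fs) = f \<otimes>\<^bsub>C\<^esub> ten_arr_list C fs"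
  by (simp_all add: ten_arr_list_def)

text \<open>The order in which the factors of the braided tensor product are listed.\<close>

definition down :: "nat \<Rightarrow> nat list" where
  "down n = rev [1..<n + 1]"

lemma down_simps [simp]: "down 0 = []" "down (Suc n) = Suc n # down n"
  by (simp_all add: down_def)

text \<open>The composite of \<open>\<xi>\<^sub>1\<^sub>l, \<dots>, \<xi>\<^sub>n\<^sub>l\<close> that moves \<open>V\<^sub>l\<close> from the right of \<open>V\<^sub>n \<otimes> \<dots> \<otimes> V\<^sub>1\<close> to its left.\<close>

primrec pass_left :: "('o, 'm, 'x) moncat_scheme \<Rightarrow> (nat \<Rightarrow> 'o)
    \<Rightarrow> (nat \<Rightarrow> nat \<Rightarrow> 'm) \<Rightarrow> nat \<Rightarrow> nat \<Rightarrow> 'm" where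
  "pass_left C V \<xi> l 0 = ide C (V l)"
| "pass_left C V \<xi> l (Suc n) =
    (\<xi> (Suc n) l \<otimes>\<^bsub>C\<^esub> ide C (ten_obj_list C (map V (down n))))
    \<cdot>\<^bsub>C\<^esub> (ide C (V (Suc n)) \<otimes>\<^bsub>C\<^esub> pass_left C V \<xi> l n)"

primrec iterated_product :: "('o, 'm, 'x) moncat_scheme \<Rightarrow> (nat \<Rightarrow> ('o, 'm) alg)
    \<Rightarrow> (nat \<Rightarrow> nat \<Rightarrow> 'm) \<Rightarrow> nat \<Rightarrow> ('o, 'm) alg" where
  "iterated_product C A \<xi> 0 = unit_algebra C"
| "iterated_product C A \<xi> (Suc n) = twisted_product C (iterated_product C A \<xi> n) (A (Suc n))
    (pass_left C (\<lambda>k. carr (A k)) \<xi> (Suc n) n)"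

lemma carr_iterated_product:
  "carr (iterated_product C A \<xi> n) = ten_obj_list C (map (\<lambda>k. carr (A k)) (down n))"
  by (induction n) simp_all

context braided_system_of_algebras begin

abbreviation "passing \<equiv> pass_left C (\<lambda>k. carr (A k)) \<xi>"
abbreviation "product \<equiv> iterated_product C A \<xi>"

lemma passing_Suc: "passing l (Suc n) =
    (\<xi> (Suc n) l \<otimes> ide C (carr (product n))) \<cdot> (ide C (carr (A (Suc n))) \<otimes> passing l n)"
  by (simp add: carr_iterated_product)

text \<open>The three claims need each other: the algebra structure on \<open>n + 1\<close> factors uses the twisting of \<open>n\<close>
  factors with the next one, that twisting extends to \<open>n + 1\<close> factors by the Yang--Baxter equation, and this
  equation is inherited as well. In effect, \<open>V\<^sub>n \<otimes> \<dots> \<otimes> V\<^sub>1\<close> can replace the first \<open>n\<close> algebras of the system.\<close>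

lemma iterated_product_system:
  assumes "n \<le> r"
  shows "unital_algebra C (product n) \<and>
    (\<forall>l. n < l \<and> l \<le> r \<longrightarrow> twisting C (product n) (A l) (passing l n)) \<and>
    (\<forall>l m. n < l \<and> l < m \<and> m \<le> r \<longrightarrow>
      yang_baxter_eq C (carr (product n)) (carr (A l)) (carr (A m)) (passing l n) (passing m n) (\<xi> l m))"
  using assms
proof (induction n)
  case 0
  have tw: "twisting C (unit_algebra C) (A l) (ide C (carr (A l)))" if "0 < l" "l \<le> r" for l
    using that algebras by (intro unital_algebra.twisting_unit_algebra) auto
  moreover have "yang_baxter_eq C \<I> (carr (A l)) (carr (A m)) (ide C (carr (A l))) (ide C (carr (A m))) (\<xi> l m)"
    if "0 < l" "l < m" "m \<le> r" for l m
  proof -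
    interpret T: twisting C "A l" "A m" "\<xi> l m" using that by (intro twisting_pair) auto
    show ?thesis by (simp add: yang_baxter_eq_def)
  qed
  ultimately show ?case using unit_algebra by simp
next
  case (Suc n)
  then have tw: "twisting C (product n) (A l) (passing l n)" if "n < l" "l \<le> r" for l
    using that by simp
  have yb: "yang_baxter_eq C (carr (product n)) (carr (A l)) (carr (A m)) (passing l n) (passing m n) (\<xi> l m)"
    if "n < l" "l < m" "m \<le> r" for l m
    using Suc that by simp
  interpret N: twisting C "product n" "A (Suc n)" "passing (Suc n) n" using Suc.prems by (intro tw) auto
  have "unital_algebra C (product (Suc n))" using N.twisted_product_algebra by simp
  moreover have "twisting C (product (Suc n)) (A l) (passing l (Suc n))" if "Suc n < l" "l \<le> r" for l
    unfolding passing_Suc iterated_product.simps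
    by (rule twisting_twisted_product) (use that in \<open>auto intro!: tw yb twisting_pair\<close>)
  moreover have "yang_baxter_eq C (carr (product (Suc n))) (carr (A l)) (carr (A m)) (passing l (Suc n)) (passing m (Suc n)) (\<xi> l m)"
    if "Suc n < l" "l < m" "m \<le> r" for l m
  proof -
    interpret X: twisting C "product n" "A l" "passing l n" using that by (intro tw) auto
    interpret X': twisting C "product n" "A m" "passing m n" using that by (intro tw) auto
    interpret Y: twisting C "A (Suc n)" "A l" "\<xi> (Suc n) l" using that by (intro twisting_pair) auto
    interpret Y': twisting C "A (Suc n)" "A m" "\<xi> (Suc n) m" using that by (intro twisting_pair) auto
    show ?thesis
      unfolding passing_Suc iterated_product.simps twisted_product_simps
      by (rule yang_baxter_ten) (use that in \<open>auto intro!: yb yang_baxter_triple X.twist_hom X'.twist_hom Y.twist_hom Y'.twist_hom \<xi>_hom\<close>)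
  qed
  ultimately show ?case by blast
qed

lemma product_algebra: "n \<le> r \<Longrightarrow> unital_algebra C (product n)"
  and product_twisting: "n < l \<Longrightarrow> l \<le> r \<Longrightarrow> twisting C (product n) (A l) (passing l n)"
  and product_yang_baxter: "n < l \<Longrightarrow> l < m \<Longrightarrow> m \<le> r \<Longrightarrow>
      yang_baxter_eq C (carr (product n)) (carr (A l)) (carr (A m)) (passing l n) (passing m n) (\<xi> l m)"
  using iterated_product_system by auto

end

section \<open>Homomorphy of the swap\<close>

text \<open>Below \<open>i\<close> the exchange only renames the strands that are being moved across.\<close>

lemma pass_left_swap:
  "n < i \<Longrightarrow> pass_left C (\<lambda>k. carr (swap_family i A k)) (swap_braiding C i \<xi>) l n
     = pass_left C (\<lambda>k. carr (A k)) \<xi> (transpose i (Suc i) l) n"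
proof (induction n)
  case 0 then show ?case by (simp add: swap_family_def)
next
  case (Suc n)
  have m: "map (\<lambda>k. carr (swap_family i A k)) (down n) = map (\<lambda>k. carr (A k)) (down n)"
    using Suc.prems by (auto simp: swap_family_def down_def)
  have "swap_family i A (Suc n) = A (Suc n)" "swap_braiding C i \<xi> (Suc n) l = \<xi> (Suc n) (transpose i (Suc i) l)"
    using Suc.prems by (auto simp: swap_family_def swap_braiding_def)
  with Suc show ?case by (simp only: pass_left.simps m)
qed

lemma iterated_product_swap:
  "n < i \<Longrightarrow> iterated_product C (swap_family i A) (swap_braiding C i \<xi>) n = iterated_product C A \<xi> n"
  by (induction n) (simp_all add: pass_left_swap, simp add: swap_family_def)

lemma swap_arrow_Suc:
  "Suc i \<le> n \<Longrightarrow> swap_arrow C (Suc n) V \<xi> i = ide C (V (Suc n)) \<otimes>\<^bsub>C\<^esub> swap_arrow C n V \<xi> i"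
  by (simp add: swap_arrow_def)

lemma (in strict_monoidal_category) ten_arr_list_ide:
  "(\<And>k. k \<in> set w \<Longrightarrow> V k \<in> obj C) \<Longrightarrow>
    ten_obj_list C (map V w) \<in> obj C \<and> ten_arr_list C (map (\<lambda>k. ide C (V k)) w) = ide C (ten_obj_list C (map V w))"
  by (induction w) auto

lemma (in strict_monoidal_category) swap_arrow_base:
  "(\<And>k. 1 \<le> k \<Longrightarrow> k \<le> j \<Longrightarrow> V k \<in> obj C) \<Longrightarrow> swap_arrow C (Suc (Suc j)) V \<xi> (Suc j)
    = inv_arr C (\<xi> (Suc j) (Suc (Suc j))) \<otimes> ide C (ten_obj_list C (map V (down j)))"
  by (subst ten_arr_list_ide[THEN conjunct2, symmetric]) (auto simp: swap_arrow_def down_def)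

locale swappable = braided_system_of_algebras +
  fixes i assumes i: "1 \<le> i" "i < r" and inv: "invertible C (\<xi> i (Suc i))"
begin

sublocale swapped: braided_system_of_algebras C r "swap_family i A" "swap_braiding C i \<xi>"
  by (rule swap_braided_system[OF i inv])

abbreviation "inverse_crossing \<equiv> inv_arr C (\<xi> i (Suc i))"

abbreviation "swap n \<equiv> swap_arrow C n (\<lambda>k. carr (A k)) \<xi> i"

lemma inverse_crossing: "inverse_arrows C (\<xi> i (Suc i)) inverse_crossing"
  by (rule inverse_arrows_inv_arr[OF inv])

lemma swap_Suc_i: "swap (Suc i) = inverse_crossing \<otimes> ide C (carr (product (i - 1)))"
proof -
  obtain j where j: "Suc j = i" "j < i" using i by (cases i) auto
  have obj: "carr (A k) \<in> obj C" if "1 \<le> k" "k \<le> j" for k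
    using algebras[of k] that i j by (auto intro: unital_algebra.carr_obj)
  show ?thesis using swap_arrow_base[of j "\<lambda>k. carr (A k)" \<xi>, OF obj]
    by (simp add: j(1)[symmetric] carr_iterated_product)
qed

lemma swap_family_values: "swap_family i A i = A (Suc i)" "swap_family i A (Suc i) = A i"
    "Suc i < l \<Longrightarrow> swap_family i A l = A l"
  by (auto simp: swap_family_def)

lemma swap_braiding_values: "swap_braiding C i \<xi> i (Suc i) = inverse_crossing"
    "Suc i < l \<Longrightarrow> swap_braiding C i \<xi> i l = \<xi> (Suc i) l"
    "Suc i < l \<Longrightarrow> swap_braiding C i \<xi> (Suc i) l = \<xi> i l"
    "Suc i < k \<Longrightarrow> Suc i < l \<Longrightarrow> swap_braiding C i \<xi> k l = \<xi> k l"
  by (auto simp: swap_braiding_def)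

lemma swapped_product_low: "n < i \<Longrightarrow> swapped.product n = product n"
  by (rule iterated_product_swap)

lemma swapped_passing_low:
  assumes "n < i"
  shows "swapped.passing i n = passing (Suc i) n" "swapped.passing (Suc i) n = passing i n"
    "Suc i < l \<Longrightarrow> swapped.passing l n = passing l n"
  using assms by (auto simp: pass_left_swap)

text \<open>With \<open>X = V\<^sub>i\<^sub>-\<^sub>1 \<otimes> \<dots> \<otimes> V\<^sub>1\<close>, associativity of twisted products exhibits source and target as the twisted
  products of \<open>X\<close> with \<open>V\<^sub>i\<^sub>+\<^sub>1 \<otimes> V\<^sub>i\<close> and with \<open>V\<^sub>i \<otimes> V\<^sub>i\<^sub>+\<^sub>1\<close>. The arrow is the tensor product of a
  homomorphism between the latter with the identity of \<open>X\<close>, and it intertwines the two twistings by the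
  Yang--Baxter equation on \<open>X \<otimes> V\<^sub>i\<^sub>+\<^sub>1 \<otimes> V\<^sub>i\<close>.\<close>

lemma swap_hom_base: "algebra_hom C (product (Suc i)) (swapped.product (Suc i)) (swap (Suc i))"
proof -
  obtain j where j: "Suc j = i" "j < i" using i by (cases i) auto
  define X where "X = product j"
  define \<alpha> where "\<alpha> = passing i j"
  define \<beta> where "\<beta> = passing (Suc i) j"
  let ?a = "carr (A i)" and ?b = "carr (A (Suc i))" and ?x = "carr X" and ?\<xi> = "\<xi> i (Suc i)"
  interpret XA: twisting C X "A i" \<alpha> unfolding X_def \<alpha>_def using i j by (intro product_twisting) auto
  interpret XB: twisting C X "A (Suc i)" \<beta> unfolding X_def \<beta>_def using i j by (intro product_twisting) auto
  interpret AB: twisting C "A i" "A (Suc i)" ?\<xi> using i by (intro twisting_pair) auto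
  interpret BA: twisting C "A (Suc i)" "A i" inverse_crossing by (rule AB.twisting_inverse[OF inverse_crossing])
  let ?\<tau> = "(ide C ?b \<otimes> \<alpha>) \<cdot> (\<beta> \<otimes> ide C ?a)" and ?\<tau>' = "(ide C ?a \<otimes> \<beta>) \<cdot> (\<alpha> \<otimes> ide C ?b)"
  \<comment> \<open>both products regrouped with the two exchanged factors as one algebra\<close>
  have 1: "product (Suc i) = twisted_product C X (twisted_product C (A i) (A (Suc i)) ?\<xi>) ?\<tau>"
  proof -
    have "product (Suc i) = twisted_product C (twisted_product C X (A i) \<alpha>) (A (Suc i)) ((?\<xi> \<otimes> ide C ?x) \<cdot> (ide C ?a \<otimes> \<beta>))"
      using passing_Suc[of "Suc i" j] iterated_product.simps(2)[of C A \<xi> j]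
      by (simp add: j X_def \<alpha>_def \<beta>_def)
    also have "\<dots> = twisted_product C X (twisted_product C (A i) (A (Suc i)) ?\<xi>) ?\<tau>"
      by (rule twisted_product_assoc) unfold_locales
    finally show ?thesis .
  qed
  have 2: "swapped.product (Suc i) = twisted_product C X (twisted_product C (A (Suc i)) (A i) inverse_crossing) ?\<tau>'"
  proof -
    have "swapped.product (Suc i) = twisted_product C (twisted_product C X (A (Suc i)) \<beta>) (A i)
        ((inverse_crossing \<otimes> ide C ?x) \<cdot> (ide C ?b \<otimes> \<alpha>))"
      using swapped.passing_Suc[of "Suc i" j] iterated_product.simps(2)[of C "swap_family i A" "swap_braiding C i \<xi>" j]
      by (simp add: j X_def \<alpha>_def \<beta>_def swap_family_values swap_braiding_values swapped_product_low swapped_passing_low)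
    also have "\<dots> = twisted_product C X (twisted_product C (A (Suc i)) (A i) inverse_crossing) ?\<tau>'"
      by (rule twisted_product_assoc) unfold_locales
    finally show ?thesis .
  qed
  have "yang_baxter_eq C ?x ?a ?b \<alpha> \<beta> ?\<xi>"
    unfolding X_def \<alpha>_def \<beta>_def using i j by (intro product_yang_baxter) auto
  then have "yang_baxter_eq C ?x ?b ?a \<beta> \<alpha> inverse_crossing"
    by (rule yang_baxter_inverse_YZ[OF _ _ _ XA.twist_hom XB.twist_hom AB.twist_hom _ inverse_crossing, rotated -1]) simp_all
  then have nat: "?\<tau>' \<cdot> (ide C ?x \<otimes> inverse_crossing) = (inverse_crossing \<otimes> ide C ?x) \<cdot> ?\<tau>"
    by (simp add: yang_baxter_eq_def)
  have "algebra_hom C (twisted_product C X (twisted_product C (A i) (A (Suc i)) ?\<xi>) ?\<tau>)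
     (twisted_product C X (twisted_product C (A (Suc i)) (A i) inverse_crossing) ?\<tau>') (inverse_crossing \<otimes> ide C ?x)"
  proof (rule twisted_product_hom)
    show "algebra_hom C X X (ide C ?x)" by unfold_locales (simp_all add: hom_iff)
    show "algebra_hom C (twisted_product C (A i) (A (Suc i)) ?\<xi>) (twisted_product C (A (Suc i)) (A i) inverse_crossing) inverse_crossing"
      by (rule AB.inverse_hom[OF inverse_crossing])
    show "unital_algebra C (twisted_product C X (twisted_product C (A i) (A (Suc i)) ?\<xi>) ?\<tau>)"
      unfolding 1[symmetric] using i by (intro product_algebra) auto
    show "unital_algebra C (twisted_product C X (twisted_product C (A (Suc i)) (A i) inverse_crossing) ?\<tau>')"
      unfolding 2[symmetric] using i by (intro swapped.product_algebra) auto
  qed (use nat in \<open>simp_all add: hom_iff\<close>)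
  then show ?thesis unfolding 1 2 swap_Suc_i by (simp add: X_def j(1)[symmetric])
qed

text \<open>Naturality is what the induction in \<open>swap_hom\<close> needs. With \<open>i + 1\<close> factors it is the Yang--Baxter equation
  for \<open>V\<^sub>i\<^sub>+\<^sub>1\<close>, \<open>V\<^sub>i\<close>, \<open>V\<^sub>l\<close>; further factors on the left do not touch the swap.\<close>

lemma passing_swap_natural:
  assumes "Suc i \<le> n" "n < l" "l \<le> r"
  shows "swap n \<in> hom C (carr (product n)) (carr (swapped.product n)) \<and>
    swapped.passing l n \<cdot> (swap n \<otimes> ide C (carr (A l))) = (ide C (carr (A l)) \<otimes> swap n) \<cdot> passing l n"
  using assms
proof (induction n arbitrary: l rule: dec_induct)
  case base
  obtain j where j: "Suc j = i" "j < i" using i by (cases i) auto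
  interpret H: algebra_hom C "product (Suc i)" "swapped.product (Suc i)" "swap (Suc i)"
    by (rule swap_hom_base)
  let ?a = "carr (A i)" and ?b = "carr (A (Suc i))" and ?d = "carr (A l)" and ?\<rho> = "passing l j"
  interpret X: twisting C "product j" "A l" ?\<rho> using base j by (intro product_twisting) auto
  interpret A: twisting C "A i" "A l" "\<xi> i l" using i base by (intro twisting_pair) auto
  interpret B: twisting C "A (Suc i)" "A l" "\<xi> (Suc i) l" using i base by (intro twisting_pair) auto
  interpret AB: twisting C "A i" "A (Suc i)" "\<xi> i (Suc i)" using i by (intro twisting_pair) auto
  interpret BA: twisting C "A (Suc i)" "A i" inverse_crossing by (rule AB.twisting_inverse[OF inverse_crossing])
  let ?x = "carr (product j)"
  have yb: "yang_baxter_eq C ?b ?a ?d inverse_crossing (\<xi> (Suc i) l) (\<xi> i l)"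
    by (rule yang_baxter_inverse_XY[OF _ _ _ _ _ _ yang_baxter_triple inverse_crossing])
      (use i base in \<open>auto simp: AB.twist_hom A.twist_hom B.twist_hom\<close>)
  have old: "passing l (Suc i) = (\<xi> (Suc i) l \<otimes> ide C (?a \<odot> ?x)) \<cdot> (ide C ?b \<otimes> ((\<xi> i l \<otimes> ide C ?x) \<cdot> (ide C ?a \<otimes> ?\<rho>)))"
    using passing_Suc[of l i] passing_Suc[of l j] iterated_product.simps(2)[of C A \<xi> j]
    by (simp add: j)
  have new: "swapped.passing l (Suc i) = (\<xi> i l \<otimes> ide C (?b \<odot> ?x)) \<cdot> (ide C ?a \<otimes> ((\<xi> (Suc i) l \<otimes> ide C ?x) \<cdot> (ide C ?b \<otimes> ?\<rho>)))"
    using swapped.passing_Suc[of l i] swapped.passing_Suc[of l j] base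
      iterated_product.simps(2)[of C "swap_family i A" "swap_braiding C i \<xi>" j]
    by (simp add: j swap_family_values swap_braiding_values swapped_product_low swapped_passing_low)
  note R = slide[of \<I> inverse_crossing \<I> ?\<rho> \<I>, simplified]
  note Y = in_context[OF yb[unfolded yang_baxter_eq_def], of \<I> ?x, simplified]
  have sw: "swap (Suc i) = inverse_crossing \<otimes> ide C ?x" using swap_Suc_i by (simp add: j(1)[symmetric])
  show ?case
  proof (intro conjI)
    show "swap (Suc i) \<in> hom C (carr (product (Suc i))) (carr (swapped.product (Suc i)))" by (rule H.hom)
    show "swapped.passing l (Suc i) \<cdot> (swap (Suc i) \<otimes> ide C ?d) = (ide C ?d \<otimes> swap (Suc i)) \<cdot> passing l (Suc i)"
      unfolding old new sw by (simp add: R R[THEN chain_eq] Y Y[THEN chain3_eq])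
  qed
next
  case (step n)
  let ?v = "carr (A (Suc n))" and ?d = "carr (A l)"
  interpret X: twisting C "product n" "A l" "passing l n" using step by (intro product_twisting) auto
  interpret X': twisting C "swapped.product n" "swap_family i A l" "swapped.passing l n"
    using step by (intro swapped.product_twisting) auto
  interpret V: twisting C "A (Suc n)" "A l" "\<xi> (Suc n) l" using step by (intro twisting_pair) auto
  have same: "swap_family i A l = A l" "swap_family i A (Suc n) = A (Suc n)" "swap_braiding C i \<xi> (Suc n) l = \<xi> (Suc n) l"
    using step by (auto simp: swap_family_values swap_braiding_values)
  note same [simp]
  have IH: "swap n \<in> hom C (carr (product n)) (carr (swapped.product n))"
    "swapped.passing l n \<cdot> (swap n \<otimes> ide C ?d) = (ide C ?d \<otimes> swap n) \<cdot> passing l n"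
    using step.IH[of l] step.prems step.hyps by auto
  have [simp]: "swap n \<in> arr C" "src C (swap n) = carr (product n)" "trg C (swap n) = carr (swapped.product n)"
    using IH(1) by (auto simp: hom_iff)
  note R = slide[of \<I> "\<xi> (Suc n) l" \<I> "swap n" \<I>, simplified]
    in_context[OF IH(2), of ?v \<I>, simplified]
  show ?case
    unfolding passing_Suc swapped.passing_Suc using step
    by (simp add: swap_arrow_Suc hom_iff R R[THEN chain_eq])
qed

lemma swap_hom:
  assumes "Suc i \<le> n" "n \<le> r"
  shows "algebra_hom C (product n) (swapped.product n) (swap n)"
  using assms
proof (induction n rule: dec_induct)
  case base
  then show ?case by (intro swap_hom_base)
next
  case (step n)
  interpret T: twisting C "product n" "A (Suc n)" "passing (Suc n) n" using step by (intro product_twisting) auto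
  interpret T': twisting C "swapped.product n" "swap_family i A (Suc n)" "swapped.passing (Suc n) n"
    using step by (intro swapped.product_twisting) auto
  have same: "swap_family i A (Suc n) = A (Suc n)"
    using step by (auto simp: swap_family_values)
  have "swap (Suc n) = ide C (carr (A (Suc n))) \<otimes> swap n" using step by (simp add: swap_arrow_Suc)
  moreover have "algebra_hom C (product (Suc n)) (swapped.product (Suc n)) (ide C (carr (A (Suc n))) \<otimes> swap n)"
    unfolding iterated_product.simps same
  proof (rule twisted_product_hom)
    show "algebra_hom C (product n) (swapped.product n) (swap n)" using step by auto
    show "algebra_hom C (A (Suc n)) (A (Suc n)) (ide C (carr (A (Suc n))))"
      by unfold_locales (simp_all add: hom_iff)
    show "swapped.passing (Suc n) n \<cdot> (swap n \<otimes> ide C (carr (A (Suc n)))) =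
      (ide C (carr (A (Suc n))) \<otimes> swap n) \<cdot> passing (Suc n) n"
      using passing_swap_natural[of n "Suc n"] step by simp
  qed (use T.twist_hom T.twisted_product_algebra T'.twist_hom T'.twisted_product_algebra same in \<open>simp_all\<close>)
  ultimately show ?case by simp
qed

lemma invertible_swap: "Suc i \<le> n \<Longrightarrow> n \<le> r \<Longrightarrow> invertible C (swap n)"
proof (induction n rule: dec_induct)
  case base
  have "carr (product (i - 1)) \<in> obj C" using product_algebra[of "i - 1"] i by (auto intro: unital_algebra.carr_obj)
  moreover have "inverse_arrows C inverse_crossing (\<xi> i (Suc i))"
    using inverse_crossing by (auto simp: inverse_arrows_def hom_iff)
  ultimately show ?case using inverse_arrows_ten inverse_arrows_ide
    unfolding swap_Suc_i invertible_def by blast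
next
  case (step n)
  have "carr (A (Suc n)) \<in> obj C" using algebras[of "Suc n"] step by (auto intro: unital_algebra.carr_obj)
  then show ?case using inverse_arrows_ten inverse_arrows_ide step
    unfolding swap_arrow_Suc[OF step.hyps(1)] invertible_def by (meson Suc_leD)
qed

end

section \<open>The braided tensor product as an iterated twisted product\<close>

definition letters :: "nat \<Rightarrow> nat list \<Rightarrow> bool" where
  "letters r w \<longleftrightarrow> (\<forall>k\<in>set w. 1 \<le> k \<and> k \<le> r)"

lemma letters_simps [simp]: "letters r []" "letters r (k # w) \<longleftrightarrow> (1 \<le> k \<and> k \<le> r) \<and> letters r w"
  "letters r (u @ v) \<longleftrightarrow> letters r u \<and> letters r v" "letters r (down n) \<longleftrightarrow> n \<le> r"
  by (auto simp: letters_def down_def)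

text \<open>The function \<open>crossings\<close> trusts the letters recorded in a step. This relation states that they are the letters
  standing at the given position of the current word, in increasing order, and it keeps the final word;
  for such lists of steps the composite is well-typed.\<close>

inductive crosses :: "nat \<Rightarrow> (nat \<times> nat \<times> nat) list \<Rightarrow> nat list \<Rightarrow> nat list \<Rightarrow> bool" for r where
  nil: "letters r w \<Longrightarrow> crosses r [] w w"
| step: "k < l \<Longrightarrow> crosses r ss (u @ l # k # v) w' \<Longrightarrow> crosses r ((k, l, Suc (length u)) # ss) (u @ k # l # v) w'"

lemma crosses_letters: "crosses r ss w w' \<Longrightarrow> letters r w \<and> letters r w'"
  by (induction rule: crosses.induct) auto

text \<open>The final word of the crossings in the multiplication: equal letters are adjacent, ready to be multiplied.\<close>

primrec doubled :: "nat \<Rightarrow> nat list" where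
  "doubled 0 = []"
| "doubled (Suc n) = Suc n # Suc n # doubled n"

lemma letters_doubled [simp]: "letters r (doubled n) \<longleftrightarrow> n \<le> r"
  by (induction n) auto

text \<open>The steps with the largest letter \<open>n + 1\<close> come first and leave two copies of it at the front; all later
  steps are those for \<open>n\<close> factors, two positions further to the right.\<close>

lemma unshuffle_Suc: "unshuffle (Suc n) = map (\<lambda>k. (k, Suc n, 1 + Suc n - k)) [1..<Suc n]
    @ map (\<lambda>(k, l, p). (k, l, p + 2)) (unshuffle n)"
proof (cases n)
  case 0
  then show ?thesis by (simp add: unshuffle_def)
next
  case (Suc m)
  have "unshuffle (Suc n) = map (\<lambda>k. (k, Suc n, 2 * Suc n + 1 - k - Suc n)) [1..<Suc n]
      @ concat (map (\<lambda>l. map (\<lambda>k. (k, l, 2 * Suc n + 1 - k - l)) [1..<l]) (rev [2..<n + 1]))"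
    using Suc by (simp add: unshuffle_def)
  also have "map (\<lambda>l. map (\<lambda>k. (k, l, 2 * Suc n + 1 - k - l)) [1..<l]) (rev [2..<n + 1])
      = map (\<lambda>l. map (\<lambda>k. (k, l, (2 * n + 1 - k - l) + 2)) [1..<l]) (rev [2..<n + 1])"
    by (intro map_cong refl) auto
  also have "concat \<dots> = map (\<lambda>(k, l, p). (k, l, p + 2)) (unshuffle n)"
    by (simp only: unshuffle_def map_concat map_map o_def prod.case)
  finally show ?thesis by simp
qed

context strict_monoidal_category begin

lemma ten_obj_list_closed: "set Xs \<subseteq> obj C \<Longrightarrow> ten_obj_list C Xs \<in> obj C"
  by (induction Xs) auto

lemma ten_obj_list_append: "set Xs \<subseteq> obj C \<Longrightarrow> set Ys \<subseteq> obj C \<Longrightarrow>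
    ten_obj_list C (Xs @ Ys) = ten_obj_list C Xs \<odot> ten_obj_list C Ys"
  by (induction Xs) (auto simp: ten_obj_list_closed)

lemma ten_arr_list_closed: "set fs \<subseteq> arr C \<Longrightarrow> ten_arr_list C fs \<in> arr C"
  by (induction fs) auto

lemma ten_arr_list_append: "set fs \<subseteq> arr C \<Longrightarrow> set gs \<subseteq> arr C \<Longrightarrow>
    ten_arr_list C (fs @ gs) = ten_arr_list C fs \<otimes> ten_arr_list C gs"
  by (induction fs) (auto simp: ten_arr_list_closed)

end

context braided_system_of_algebras begin

definition "word_obj w = ten_obj_list C (map (\<lambda>k. carr (A k)) w)"

abbreviation "crossing \<equiv> crossings C (\<lambda>k. carr (A k)) \<xi>"

lemma carr_obj [simp]: "Suc 0 \<le> k \<Longrightarrow> k \<le> r \<Longrightarrow> carr (A k) \<in> obj C"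
  using algebras by (auto intro: unital_algebra.carr_obj)

lemma word_obj [simp]: "letters r w \<Longrightarrow> word_obj w \<in> obj C"
  unfolding word_obj_def by (intro ten_obj_list_closed) (auto simp: letters_def)

lemma word_obj_simps [simp]: "word_obj [] = \<I>" "word_obj (k # w) = carr (A k) \<odot> word_obj w"
  "letters r u \<Longrightarrow> letters r v \<Longrightarrow> word_obj (u @ v) = word_obj u \<odot> word_obj v"
  "word_obj (down n) = carr (product n)"
  unfolding word_obj_def map_append
  by (simp_all add: carr_iterated_product, intro ten_obj_list_append) (auto simp: letters_def)

lemma crossing_Nil [simp]: "crossing [] w = ide C (word_obj w)"
  by (simp add: word_obj_def)

\<comment> \<open>\<open>crossing_step\<close> replaces the defining equations, with the position read off from a splitting of the word\<close>
declare crossings.simps [simp del]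

lemma at_position_append:
  assumes "letters r u" "letters r v" "f \<in> arr C"
  shows "at_position C (\<lambda>k. carr (A k)) f (Suc (length u)) (u @ k # l # v)
    = ide C (word_obj u) \<otimes> f \<otimes> ide C (word_obj v)"
proof -
  have ide: "ten_arr_list C (map (\<lambda>k. ide C (carr (A k))) w) = ide C (word_obj w)" if "letters r w" for w
    unfolding word_obj_def by (intro ten_arr_list_ide[THEN conjunct2]) (use that in \<open>auto simp: letters_def\<close>)
  show ?thesis unfolding at_position_def
    by (subst ten_arr_list_append) (use assms in \<open>auto simp: ide, auto simp: letters_def\<close>)
qed

lemma crossing_step:
  assumes "k < l" "letters r (u @ k # l # v)"
  shows "crossing ((k, l, Suc (length u)) # ss) (u @ k # l # v)
    = crossing ss (u @ l # k # v) \<cdot> (ide C (word_obj u) \<otimes> \<xi> k l \<otimes> ide C (word_obj v))"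
proof -
  interpret twisting C "A k" "A l" "\<xi> k l" using assms by (intro twisting_pair) auto
  show ?thesis using assms by (simp add: at_position_append crossings.simps)
qed

lemma crossing_hom: "crosses r ss w w' \<Longrightarrow> crossing ss w \<in> hom C (word_obj w) (word_obj w')"
proof (induction rule: crosses.induct)
  case (nil w)
  then show ?case by (simp add: hom_iff)
next
  case (step k l ss u v w')
  have s: "letters r (u @ k # l # v)" using crosses_letters[OF step.hyps(2)] by auto
  interpret twisting C "A k" "A l" "\<xi> k l" using step s by (intro twisting_pair) auto
  show ?case unfolding crossing_step[OF step.hyps(1) s]
    using step.IH s by (auto simp add: hom_iff)
qed

lemma crossing_append:
  assumes "crosses r ss w w'" "crosses r ts w' w''"
  shows "crosses r (ss @ ts) w w''" and "crossing (ss @ ts) w = crossing ts w' \<cdot> crossing ss w"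
proof -
  from assms show "crosses r (ss @ ts) w w''"
    by (induction rule: crosses.induct) (auto intro: crosses.intros)
  from assms show "crossing (ss @ ts) w = crossing ts w' \<cdot> crossing ss w"
  proof (induction rule: crosses.induct)
    case (nil w)
    then show ?case using crossing_hom[of ts w w''] by (simp add: hom_iff)
  next
    case (step k l ss u v w')
    have s: "letters r (u @ k # l # v)" using crosses_letters[OF step.hyps(2)] by auto
    interpret twisting C "A k" "A l" "\<xi> k l" using step s by (intro twisting_pair) auto
    show ?case
      using step crossing_hom[OF step.hyps(2)] crossing_hom[OF step.prems] s
      by (simp only: append_Cons crossing_step[OF step.hyps(1) s]) (simp add: hom_iff)
  qed
qed

lemma crossing_shift:
  assumes "crosses r ss w w'" "letters r t"
  shows "crosses r (map (\<lambda>(k, l, p). (k, l, p + length t)) ss) (t @ w) (t @ w') \<and>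
    crossing (map (\<lambda>(k, l, p). (k, l, p + length t)) ss) (t @ w) = ide C (word_obj t) \<otimes> crossing ss w"
  using assms
proof (induction rule: crosses.induct)
  case (nil w)
  then show ?case by (simp add: crosses.nil)
next
  case (step k l ss u v w')
  have s: "letters r (u @ k # l # v)" using crosses_letters[OF step.hyps(2)] by auto
  interpret twisting C "A k" "A l" "\<xi> k l" using step s by (intro twisting_pair) auto
  let ?ss = "map (\<lambda>(k, l, p). (k, l, p + length t)) ss"
  have IH: "crosses r ?ss ((t @ u) @ l # k # v) (t @ w')"
    "crossing ?ss ((t @ u) @ l # k # v) = ide C (word_obj t) \<otimes> crossing ss (u @ l # k # v)"
    using step by auto
  have s': "letters r ((t @ u) @ k # l # v)" using s step.prems by auto
  have "crosses r ((k, l, Suc (length (t @ u))) # ?ss) ((t @ u) @ k # l # v) (t @ w')"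
    by (rule crosses.step[OF step.hyps(1) IH(1)])
  moreover have "crossing ((k, l, Suc (length (t @ u))) # ?ss) ((t @ u) @ k # l # v)
      = ide C (word_obj t) \<otimes> crossing ((k, l, Suc (length u)) # ss) (u @ k # l # v)"
    unfolding crossing_step[OF step.hyps(1) s] crossing_step[OF step.hyps(1) s'] IH
    using s step.prems crossing_hom[OF step.hyps(2), unfolded hom_iff] by simp
  ultimately show ?case by (simp add: add.commute)
qed

text \<open>The letter \<open>l\<close> stands to the right of \<open>n, \<dots>, 1\<close>, so it passes \<open>1\<close> first, at the rightmost position, and
  then moves one position to the left with each further letter.\<close>

lemma crossing_pass_left:
  assumes "n < l" "l \<le> r" "letters r u" "letters r v"
  defines "ss \<equiv> map (\<lambda>k. (k, l, length u + Suc n - k)) [1..<Suc n]"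
  shows "crosses r ss (u @ down n @ l # v) (u @ l # down n @ v) \<and>
    crossing ss (u @ down n @ l # v) = ide C (word_obj u) \<otimes> passing l n \<otimes> ide C (word_obj v)"
  using assms(1-4) unfolding ss_def
proof (induction n arbitrary: u)
  case 0
  show ?case using 0 by (auto intro!: crosses.nil)
next
  case (Suc n)
  interpret P: twisting C "product n" "A l" "passing l n" using Suc.prems by (intro product_twisting) auto
  interpret T: twisting C "A (Suc n)" "A l" "\<xi> (Suc n) l" using Suc.prems by (intro twisting_pair) auto
  let ?ss = "map (\<lambda>k. (k, l, length (u @ [Suc n]) + Suc n - k)) [1..<Suc n]"
  have letters: "letters r (u @ Suc n # l # down n @ v)" using Suc.prems by auto
  have IH: "crosses r ?ss (u @ Suc n # down n @ l # v) (u @ Suc n # l # down n @ v)"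
    "crossing ?ss (u @ Suc n # down n @ l # v) = ide C (word_obj (u @ [Suc n])) \<otimes> passing l n \<otimes> ide C (word_obj v)"
    using Suc.IH[of "u @ [Suc n]"] Suc.prems by simp_all
  have last: "crosses r [(Suc n, l, Suc (length u))] (u @ Suc n # l # down n @ v) (u @ l # Suc n # down n @ v)"
    by (rule crosses.step[OF _ crosses.nil]) (use Suc.prems in auto)
  \<comment> \<open>the letter \<open>n + 1\<close> joins the untouched prefix while \<open>l\<close> passes the letters \<open>n, \<dots>, 1\<close>, and is passed last\<close>
  have split: "map (\<lambda>k. (k, l, length u + Suc (Suc n) - k)) [1..<Suc (Suc n)] = ?ss @ [(Suc n, l, Suc (length u))]"
    by simp
  show ?case
    unfolding split passing_Suc
    using crossing_append[OF IH(1) last, unfolded IH(2)] Suc.prems letters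
    by (simp add: crossing_step del: upt_Suc)
qed

lemma crossing_unshuffle_Suc:
  assumes n: "Suc n \<le> r" and c: "crosses r (unshuffle n) (down n @ down n) (doubled n)"
  shows "crosses r (unshuffle (Suc n)) (down (Suc n) @ down (Suc n)) (doubled (Suc n))"
   and "crossing (unshuffle (Suc n)) (down (Suc n) @ down (Suc n)) =
     (ide C (carr (A (Suc n)) \<odot> carr (A (Suc n))) \<otimes> crossing (unshuffle n) (down n @ down n))
     \<cdot> (ide C (carr (A (Suc n))) \<otimes> passing (Suc n) n \<otimes> ide C (carr (product n)))"
proof -
  have pass: "crosses r (map (\<lambda>k. (k, Suc n, 1 + Suc n - k)) [1..<Suc n])
      (Suc n # down n @ Suc n # down n) (Suc n # Suc n # down n @ down n)"
    "crossing (map (\<lambda>k. (k, Suc n, 1 + Suc n - k)) [1..<Suc n]) (Suc n # down n @ Suc n # down n)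
      = ide C (carr (A (Suc n))) \<otimes> passing (Suc n) n \<otimes> ide C (carr (product n))"
    using crossing_pass_left[of n "Suc n" "[Suc n]" "down n"] n by (simp_all del: upt_Suc)
  have shift: "crosses r (map (\<lambda>(k, l, p). (k, l, p + 2)) (unshuffle n))
      (Suc n # Suc n # down n @ down n) (doubled (Suc n))"
    "crossing (map (\<lambda>(k, l, p). (k, l, p + 2)) (unshuffle n)) (Suc n # Suc n # down n @ down n)
      = ide C (carr (A (Suc n)) \<odot> carr (A (Suc n))) \<otimes> crossing (unshuffle n) (down n @ down n)"
    using crossing_shift[OF c, of "[Suc n, Suc n]"] n by simp_all
  show "crosses r (unshuffle (Suc n)) (down (Suc n) @ down (Suc n)) (doubled (Suc n))"
    "crossing (unshuffle (Suc n)) (down (Suc n) @ down (Suc n)) =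
     (ide C (carr (A (Suc n)) \<odot> carr (A (Suc n))) \<otimes> crossing (unshuffle n) (down n @ down n))
     \<cdot> (ide C (carr (A (Suc n))) \<otimes> passing (Suc n) n \<otimes> ide C (carr (product n)))"
    using crossing_append[OF pass(1) shift(1), unfolded pass(2) shift(2)]
    unfolding unshuffle_Suc down_simps append_Cons by blast+
qed

lemma crosses_unshuffle: "n \<le> r \<Longrightarrow> crosses r (unshuffle n) (down n @ down n) (doubled n)"
  by (induction n) (simp add: unshuffle_def crosses.nil, simp add: crossing_unshuffle_Suc(1) del: down_simps doubled.simps)

lemma ten_arr_list_mul:
  "n \<le> r \<Longrightarrow> ten_arr_list C (map (\<lambda>k. mul (A k)) (down n)) \<in> hom C (word_obj (doubled n)) (word_obj (down n))"
proof (induction n)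
  case (Suc n)
  interpret unital_algebra C "A (Suc n)" using Suc by (intro algebras) auto
  have [simp]: "carr (product n) \<in> obj C" using product_algebra[of n] Suc.prems by (auto intro: unital_algebra.carr_obj)
  from Suc show ?case by (simp add: hom_iff)
qed (simp add: hom_iff)

text \<open>By the recursion for the crossings, the multiplication on \<open>n + 1\<close> factors is \<open>\<mu>\<^sub>n\<^sub>+\<^sub>1\<close> next to the whole
  multiplication on \<open>n\<close> factors, preceded by the passage of the second \<open>V\<^sub>n\<^sub>+\<^sub>1\<close> to the left.\<close>

lemma braided_tensor_product_eq_product: "n \<le> r \<Longrightarrow> braided_tensor_product C n A \<xi> = product n"
proof (induction n)
  case 0
  show ?case by (simp add: braided_tensor_product_def unshuffle_def unit_algebra_def crossings.simps)
next
  case (Suc n)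
  interpret V: unital_algebra C "A (Suc n)" using Suc by (intro algebras) auto
  interpret N: unital_algebra C "product n" using Suc by (intro product_algebra) auto
  interpret T: twisting C "product n" "A (Suc n)" "passing (Suc n) n" using Suc by (intro product_twisting) auto
  let ?M = "ten_arr_list C (map (\<lambda>k. mul (A k)) (down n))" and ?c = "crossing (unshuffle n) (down n @ down n)"
  let ?v = "carr (A (Suc n))"
  have unfold: "braided_tensor_product C m A \<xi> = \<lparr>carr = word_obj (down m),
      mul = ten_arr_list C (map (\<lambda>k. mul (A k)) (down m)) \<cdot> crossing (unshuffle m) (down m @ down m),
      unt = ten_arr_list C (map (\<lambda>k. unt (A k)) (down m))\<rparr>" for m
    by (simp only: braided_tensor_product_def Let_def down_def word_obj_def)
  have IH: "?M \<cdot> ?c = mul (product n)" "ten_arr_list C (map (\<lambda>k. unt (A k)) (down n)) = unt (product n)"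
    using Suc unfold[of n] by (auto dest: arg_cong[of _ _ mul] arg_cong[of _ _ unt])
  have [simp]: "?M \<in> arr C" "?c \<in> arr C" "src C ?M = trg C ?c" "src C ?c = carr (product n) \<odot> carr (product n)"
    "trg C ?M = carr (product n)" "trg C ?c = word_obj (doubled n)"
    using ten_arr_list_mul[of n] crossing_hom[OF crosses_unshuffle[of n]] Suc.prems by (auto simp: hom_iff)
  have "(mul (A (Suc n)) \<otimes> ?M) \<cdot> (ide C (?v \<odot> ?v) \<otimes> ?c) = mul (A (Suc n)) \<otimes> mul (product n)"
    using ten_comp_left[of "mul (A (Suc n))" ?c ?M] by (simp add: IH)
  from chain_eq[OF this, of "ide C ?v \<otimes> passing (Suc n) n \<otimes> ide C (carr (product n))"]
  have "(mul (A (Suc n)) \<otimes> ?M) \<cdot> crossing (unshuffle (Suc n)) (down (Suc n) @ down (Suc n)) = mul (product (Suc n))"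
    using crossing_unshuffle_Suc(2)[of n] crosses_unshuffle[of n] Suc.prems by (simp del: down_simps)
  then show ?case unfolding unfold[of "Suc n"] by (simp add: IH twisted_product_def)
qed

end

section \<open>Restriction of scalars\<close>

lemma (in algebra_hom) inverse_algebra_hom:
  assumes "inverse_arrows C f g"
  shows "algebra_hom C B A g"
proof -
  have [simp]: "f \<in> arr C" "src C f = carr A" "trg C f = carr B" "g \<in> arr C" "src C g = carr B" "trg C g = carr A"
    and inv: "g \<cdot> f = ide C (carr A)" "f \<cdot> g = ide C (carr B)"
    using hom assms by (auto simp: hom_iff inverse_arrows_def)
  have "(f \<otimes> f) \<cdot> (g \<otimes> g) = ide C (carr B \<odot> carr B)"
    using interchange_arr[of g f g f] by (simp add: inv)
  show ?thesis
  proof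
    show "g \<in> hom C (carr B) (carr A)" by (simp add: hom_iff)
    have "g \<cdot> mul B = g \<cdot> mul B \<cdot> ((f \<otimes> f) \<cdot> (g \<otimes> g))" by (simp add: \<open>(f \<otimes> f) \<cdot> (g \<otimes> g) = _\<close>)
    also have "\<dots> = g \<cdot> (mul B \<cdot> (f \<otimes> f)) \<cdot> (g \<otimes> g)" by simp
    also have "\<dots> = mul A \<cdot> (g \<otimes> g)" by (simp add: hom_mul[symmetric] inv[THEN chain_eq])
    finally show "g \<cdot> mul B = mul A \<cdot> (g \<otimes> g)" .
    show "g \<cdot> unt B = unt A" by (simp add: hom_unt[symmetric] inv[THEN chain_eq])
  qed
qed

lemma (in unital_algebra) category_Mod: "category (Mod C A)"
proof
  show "f \<in> arr (Mod C A) \<Longrightarrow> src (Mod C A) f \<in> obj (Mod C A)"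
   and "f \<in> arr (Mod C A) \<Longrightarrow> trg (Mod C A) f \<in> obj (Mod C A)" for f
    by (auto simp: Mod_def)
  show "ide (Mod C A) P \<in> Defs.hom (Mod C A) P P" if "P \<in> obj (Mod C A)" for P
    using that by (auto simp: Mod_def hom_def right_module_def module_hom_def)
  have module_hom_comp: "module_hom C A P R (g \<cdot> f)"
    if "right_module C A P" "right_module C A Q" "right_module C A R"
      "module_hom C A P Q f" "module_hom C A Q R g" for P Q R f g
  proof -
    obtain M \<rho> N \<tau> L \<sigma> where [simp]: "P = (M, \<rho>)" "Q = (N, \<tau>)" "R = (L, \<sigma>)" by (metis surj_pair)
    have [simp]: "M \<in> obj C" "N \<in> obj C" "L \<in> obj C" "\<rho> \<in> arr C" "src C \<rho> = M \<odot> carr A" "trg C \<rho> = M"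
      "\<tau> \<in> arr C" "src C \<tau> = N \<odot> carr A" "trg C \<tau> = N" "\<sigma> \<in> arr C" "src C \<sigma> = L \<odot> carr A" "trg C \<sigma> = L"
      "f \<in> arr C" "src C f = M" "trg C f = N" "g \<in> arr C" "src C g = N" "trg C g = L"
      and f: "f \<cdot> \<rho> = \<tau> \<cdot> (f \<otimes> ide C (carr A))" and g: "g \<cdot> \<tau> = \<sigma> \<cdot> (g \<otimes> ide C (carr A))"
      using that by (auto simp: right_module_def module_hom_def hom_iff)
    show ?thesis by (simp add: module_hom_def hom_iff f g[THEN chain_eq])
  qed
  show "comp (Mod C A) g f \<in> Defs.hom (Mod C A) P R"
    if "f \<in> Defs.hom (Mod C A) P Q" "g \<in> Defs.hom (Mod C A) Q R" for f g P Q R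
    using that by (auto simp: Mod_def hom_def intro: module_hom_comp)
  show "comp (Mod C A) (ide (Mod C A) Q) f = f" "comp (Mod C A) f (ide (Mod C A) P) = f"
    if "f \<in> Defs.hom (Mod C A) P Q" for f P Q
    using that by (auto simp: Mod_def hom_def module_hom_def)
  show "comp (Mod C A) (comp (Mod C A) h g) f = comp (Mod C A) h (comp (Mod C A) g f)"
    if "f \<in> Defs.hom (Mod C A) P Q" "g \<in> Defs.hom (Mod C A) Q R" "h \<in> Defs.hom (Mod C A) R S" for f g h P Q R S
    using that by (auto simp: Mod_def hom_def module_hom_def)
qed

lemma (in algebra_hom) right_module_pull_action:
  assumes "right_module C B P"
  shows "right_module C A (pull_action C f P)"
proof -
  obtain M \<rho> where [simp]: "P = (M, \<rho>)" by (cases P)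
  have [simp]: "f \<in> arr C" "src C f = carr A" "trg C f = carr B" using hom by (auto simp: hom_iff)
  have [simp]: "M \<in> obj C" "\<rho> \<in> arr C" "src C \<rho> = M \<odot> carr B" "trg C \<rho> = M"
    and act: "\<rho> \<cdot> (\<rho> \<otimes> ide C (carr B)) = \<rho> \<cdot> (ide C M \<otimes> mul B)" "\<rho> \<cdot> (ide C M \<otimes> unt B) = ide C M"
    using assms by (auto simp: right_module_def hom_iff)
  note R = slide[of \<I> \<rho> \<I> f \<I>, simplified] slide[of M f \<I> f \<I>, simplified]
    in_context[OF hom_mul, of M \<I>, simplified, simplified ten_split[of f f], simplified]
    in_context[OF hom_unt, of M \<I>, simplified]
  show ?thesis
    by (simp add: right_module_def pull_action_def hom_iff R R[THEN chain_eq] act act[THEN chain_eq] ten_split[of f f])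
qed

lemma (in algebra_hom) cat_functor_restrict_scalars:
  "cat_functor (Mod C B) (Mod C A) (restrict_scalars C f)"
proof -
  have [simp]: "f \<in> arr C" "src C f = carr A" "trg C f = carr B" using hom by (auto simp: hom_iff)
  have module_hom_pull: "module_hom C A (pull_action C f P) (pull_action C f Q) h"
    if "right_module C B P" "right_module C B Q" "module_hom C B P Q h" for P Q h
  proof -
    obtain M \<rho> N \<tau> where [simp]: "P = (M, \<rho>)" "Q = (N, \<tau>)" by (metis surj_pair)
    have [simp]: "M \<in> obj C" "N \<in> obj C" "\<rho> \<in> arr C" "src C \<rho> = M \<odot> carr B" "trg C \<rho> = M"
      "\<tau> \<in> arr C" "src C \<tau> = N \<odot> carr B" "trg C \<tau> = N" "h \<in> arr C" "src C h = M" "trg C h = N"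
      and h: "h \<cdot> \<rho> = \<tau> \<cdot> (h \<otimes> ide C (carr B))"
      using that by (auto simp: right_module_def module_hom_def hom_iff)
    note R = slide[of \<I> h \<I> f \<I>, simplified]
    show ?thesis by (simp add: module_hom_def pull_action_def hom_iff h[THEN chain_eq] R)
  qed
  interpret A: category "Mod C A" by (rule category_Mod)
  interpret B: category "Mod C B" by (rule B.category_Mod)
  show ?thesis
    by unfold_locales (auto simp: Mod_def restrict_scalars_def hom_def right_module_pull_action module_hom_pull,
      auto simp: pull_action_def)
qed

lemma (in category) naturally_isomorphic_id:
  assumes "\<And>X. X \<in> obj C \<Longrightarrow> on_obj F X = X" "\<And>f. f \<in> arr C \<Longrightarrow> on_arr F f = f"
  shows "naturally_isomorphic C C F id_func"
  unfolding naturally_isomorphic_def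
proof (intro exI[of _ "ide C"] conjI ballI)
  fix X assume "X \<in> obj C"
  then show "ide C X \<in> hom C (on_obj F X) (on_obj id_func X)" "invertible C (ide C X)"
    using inverse_arrows_ide assms by (auto simp: id_func_def hom_iff invertible_def)
qed (simp add: assms id_func_def)

lemma (in strict_monoidal_category) pull_action_inverse:
  assumes "M \<in> obj C" "\<rho> \<in> arr C" "src C \<rho> = M \<odot> trg C g" "inverse_arrows C f g"
  shows "pull_action C f (pull_action C g (M, \<rho>)) = (M, \<rho>)"
proof -
  have [simp]: "f \<in> arr C" "g \<in> arr C" "src C g = trg C f" "trg C g = src C f" "g \<cdot> f = ide C (src C f)"
    using assms(4) by (auto simp: inverse_arrows_def hom_iff)
  have "(ide C M \<otimes> g) \<cdot> (ide C M \<otimes> f) = ide C (M \<odot> src C f)"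
    using whisker_left[of f g M] assms by simp
  then show ?thesis using assms by (simp add: pull_action_def)
qed

text \<open>The two functors compose to functors that fix every module and every arrow, so identities
  provide the natural isomorphisms.\<close>

lemma cat_equivalence_restrict_scalars:
  fixes C :: "('o, 'm, 'x) moncat_scheme" (structure)
  assumes "algebra_hom C A B f" "algebra_hom C B A g" "inverse_arrows C f g"
  shows "cat_equivalence (Mod C A) (Mod C B) (restrict_scalars C g) (restrict_scalars C f)"
proof -
  interpret F: algebra_hom C A B f by fact
  interpret G: algebra_hom C B A g by fact
  interpret MA: category "Mod C A" by (rule F.category_Mod)
  interpret MB: category "Mod C B" by (rule F.B.category_Mod)
  have inv: "inverse_arrows C g f" using assms(3) by (auto simp: inverse_arrows_def F.hom_iff)
  have pull: "pull_action C f (pull_action C g P) = P" if "right_module C A P" for P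
    using that F.pull_action_inverse[OF _ _ _ assms(3)] G.hom
    by (cases P) (auto simp: right_module_def F.hom_iff)
  have pull': "pull_action C g (pull_action C f P) = P" if "right_module C B P" for P
    using that F.pull_action_inverse[OF _ _ _ inv] F.hom
    by (cases P) (auto simp: right_module_def F.hom_iff)
  have "naturally_isomorphic (Mod C A) (Mod C A) (comp_func (restrict_scalars C f) (restrict_scalars C g)) id_func"
    by (rule MA.naturally_isomorphic_id) (auto simp: comp_func_def restrict_scalars_def Mod_def pull)
  moreover have "naturally_isomorphic (Mod C B) (Mod C B) (comp_func (restrict_scalars C g) (restrict_scalars C f)) id_func"
    by (rule MB.naturally_isomorphic_id) (auto simp: comp_func_def restrict_scalars_def Mod_def pull')
  ultimately show ?thesis
    unfolding cat_equivalence_def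
    using F.cat_functor_restrict_scalars G.cat_functor_restrict_scalars by blast
qed

theorem proposition4p11:
  fixes C :: "('o, 'm, 'x) moncat_scheme" (structure)
    and r i :: nat
    and A :: "nat \<Rightarrow> ('o, 'm) alg"
    and \<epsilon> :: "nat \<Rightarrow> 'm"
    and \<xi> :: "nat \<Rightarrow> nat \<Rightarrow> 'm"
  defines "A' \<equiv> swap_family i A"
    and "\<xi>' \<equiv> swap_braiding C i \<xi>"
    and "W \<equiv> braided_tensor_product C r A \<xi>"
    and "W' \<equiv> braided_tensor_product C r (swap_family i A) (swap_braiding C i \<xi>)"
    and "s \<equiv> swap_arrow C r (\<lambda>k. carr (A k)) \<xi> i"
  assumes "strict_monoidal_category C"
    and "\<And>k. 1 \<le> k \<Longrightarrow> k \<le> r \<Longrightarrow> unital_algebra C (A k)"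
    and "\<And>k. 1 \<le> k \<Longrightarrow> k \<le> r \<Longrightarrow> normalized_pair C (carr (A k)) (unt (A k)) (\<epsilon> k)"
    and "braided_system_of_algebras C r A \<xi>"
    and "1 \<le> i" and "i < r"
    and "invertible C (\<xi> i (i + 1))"
  shows "braided_system_of_algebras C r A' \<xi>'
    \<and> algebra_iso C W W' s
    \<and> cat_equivalence (Mod C W) (Mod C W')
        (restrict_scalars C (inv_arr C s)) (restrict_scalars C s)
    \<and> (\<forall>(M, \<rho>) \<in> obj (Mod C W).
        on_obj (restrict_scalars C (inv_arr C s)) (M, \<rho>) = (M, \<rho> \<cdot> (ide C M \<otimes> inv_arr C s))
        \<and> on_obj (restrict_scalars C s) (M, \<rho> \<cdot> (ide C M \<otimes> inv_arr C s)) = (M, \<rho>))"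
proof -
  interpret swappable C r A \<xi> i
    using assms by (simp add: swappable_def swappable_axioms_def)
  have W: "W = product r" "W' = swapped.product r" "s = swap r"
    unfolding W_def W'_def s_def
    by (simp_all add: braided_tensor_product_eq_product swapped.braided_tensor_product_eq_product)
  interpret S: algebra_hom C W W' s
    unfolding W using i by (intro swap_hom) auto
  have inverse: "inverse_arrows C s (inv_arr C s)"
    unfolding W using i by (intro inverse_arrows_inv_arr invertible_swap) auto
  interpret S': algebra_hom C W' W "inv_arr C s"
    by (rule S.inverse_algebra_hom[OF inverse])
  have "braided_system_of_algebras C r A' \<xi>'"
    unfolding A'_def \<xi>'_def by (rule swapped.braided_system_of_algebras_axioms)
  moreover have "algebra_iso C W W' s"
    unfolding algebra_iso_def using S.algebra_hom_axioms S'.algebra_hom_axioms inverse by blast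
  moreover have "cat_equivalence (Mod C W) (Mod C W') (restrict_scalars C (inv_arr C s)) (restrict_scalars C s)"
    by (rule cat_equivalence_restrict_scalars[OF S.algebra_hom_axioms S'.algebra_hom_axioms inverse])
  moreover have "on_obj (restrict_scalars C (inv_arr C s)) (M, \<rho>) = (M, \<rho> \<cdot> (ide C M \<otimes> inv_arr C s))
        \<and> on_obj (restrict_scalars C s) (M, \<rho> \<cdot> (ide C M \<otimes> inv_arr C s)) = (M, \<rho>)"
    if "(M, \<rho>) \<in> obj (Mod C W)" for M \<rho>
  proof -
    have "right_module C W (M, \<rho>)" using that by (simp add: Mod_def)
    then have "pull_action C s (pull_action C (inv_arr C s) (M, \<rho>)) = (M, \<rho>)"
      using S'.hom by (intro pull_action_inverse[OF _ _ _ inverse]) (auto simp: right_module_def hom_iff)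
    then show ?thesis by (simp add: restrict_scalars_def pull_action_def)
  qed
  ultimately show ?thesis by auto
qed

end
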